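(* Fix a commutative $\Bbbk$-algebra $A$. Then the correspondence $$\mathscr L:\mathsf{CHAlgd}_A\longrightarrow\mathsf{LieRin}_A,\qquad \mathcal H\longmapsto\mathscr L(\mathcal H):=\mathrm{Der}_\Bbbk^{\,s}(\mathcal H,A_\varepsilon),$$ acting on morphisms $\phi:\mathcal H\to\mathcal K$ by $\mathscr L_\phi:\mathscr L(\mathcal K)\to\mathscr L(\mathcal H)$, $\delta\mapsto\delta\circ\phi$, establishes a contravariant functor from the category of commutative Hopf algebroids with base algebra $A$ to the category of Lie-Rinehart algebras over $A$.
   Context: $\Bbbk$ is a field of characteristic $0$. A commutative Hopf algebroid $(A,\mathcal H)$ over $\Bbbk$ consists of commutative $\Bbbk$-algebras with algebra maps $s,t:A\to\mathcal H$, $\Delta:\mathcal H\to\mathcal H\otimes_A\mathcal H$ ($u\mapsto u_1\otimes_Au_2$), $\varepsilon:\mathcal H\to A$, $\mathcal S:\mathcal H\to\mathcal H$, where $\mathcal H$ is the $A$-bimodule ${}_s\mathcal H_t$ (left via $s$, right via $t$), $\Delta,\varepsilon$ are $A$-bilinear, coassociative and counital, $\mathcal Ss=t$, $\mathcal St=s$, $\mathcal S^2=\mathrm{id}$, $\mathcal S(h_1)h_2=t(\varepsilon(h))$, $h_1\mathcal S(h_2)=s(\varepsilon(h))$. $\mathsf{CHAlgd}_A$ is the category of these with $A$ fixed; morphisms are algebra maps commuting with all structure maps. $\mathrm{Der}_\Bbbk^{\,s}(\mathcal H,A_\varepsilon)$ is the set of $\Bbbk$-linear $\delta:\mathcal H\to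 A$ with $\delta\circ s=0$ and $\delta(uv)=\varepsilon(u)\delta(v)+\delta(u)\varepsilon(v)$, with $A$-action $(a\delta)(u)=a\delta(u)$, bracket $[\delta,\delta'](u)=\delta(u_1t(\delta'(u_2)))-\delta'(u_1t(\delta(u_2)))$ and anchor $\delta\mapsto\delta\circ t\in\mathrm{Der}_\Bbbk(A)$. A Lie-Rinehart algebra $(A,L)$ is a Lie $\Bbbk$-algebra $L$ that is also an $A$-module, with an $A$-linear Lie algebra map $\omega:L\to\mathrm{Der}_\Bbbk(A)$ (anchor) such that $[X,aY]=a[X,Y]+\omega(X)(a)Y$. $\mathsf{LieRin}_A$ is the category of these; morphisms are $A$-linear Lie algebra maps commuting with the anchors. *)

theory Defs
  imports "HOL-Algebra.Module" "HOL-Algebra.Free_Abelian_Groups" "HOL-Algebra.Generated_Groups"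
begin

section \<open>Categories and contravariant functors\<close>

text \<open>
  Hom-sets are indexed by pairs of objects and need not be disjoint, so identities, composition
  (\<^term>\<open>Comp C X Y Z g f\<close> is \<open>g\<close> after \<open>f\<close>) and the arrow part of a functor
  take the objects involved as arguments.
\<close>

record ('o, 'm) category =
  Obj :: "'o set"
  Hom :: "'o \<Rightarrow> 'o \<Rightarrow> 'm set"
  Idt :: "'o \<Rightarrow> 'm"
  Comp :: "'o \<Rightarrow> 'o \<Rightarrow> 'o \<Rightarrow> 'm \<Rightarrow> 'm \<Rightarrow> 'm"

locale category =
  fixes C :: "('o, 'm) category"
  assumes Idt_in_Hom: "X \<in> Obj C \<Longrightarrow> Idt C X \<in> Hom C X X"
    and Comp_in_Hom:
      "\<lbrakk>X \<in> Obj C; Y \<in> Obj C; Z \<in> Obj C; f \<in> Hom C X Y; g \<in> Hom C Y Z\<rbrakk>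
       \<Longrightarrow> Comp C X Y Z g f \<in> Hom C X Z"
    and Comp_Idt_right:
      "\<lbrakk>X \<in> Obj C; Y \<in> Obj C; f \<in> Hom C X Y\<rbrakk> \<Longrightarrow> Comp C X X Y f (Idt C X) = f"
    and Comp_Idt_left:
      "\<lbrakk>X \<in> Obj C; Y \<in> Obj C; f \<in> Hom C X Y\<rbrakk> \<Longrightarrow> Comp C X Y Y (Idt C Y) f = f"
    and Comp_assoc:
      "\<lbrakk>W \<in> Obj C; X \<in> Obj C; Y \<in> Obj C; Z \<in> Obj C;
        f \<in> Hom C W X; g \<in> Hom C X Y; h \<in> Hom C Y Z\<rbrakk>
       \<Longrightarrow> Comp C W Y Z h (Comp C W X Y g f) = Comp C W X Z (Comp C X Y Z h g) f"

locale contravariant_functor = C: category C + D: category D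
  for C :: "('o, 'm) category" and D :: "('p, 'n) category" +
  fixes F :: "'o \<Rightarrow> 'p" and F_arr :: "'o \<Rightarrow> 'o \<Rightarrow> 'm \<Rightarrow> 'n"
  assumes F_Obj: "X \<in> Obj C \<Longrightarrow> F X \<in> Obj D"
    and F_Hom: "\<lbrakk>X \<in> Obj C; Y \<in> Obj C; f \<in> Hom C X Y\<rbrakk> \<Longrightarrow> F_arr X Y f \<in> Hom D (F Y) (F X)"
    and F_Idt: "X \<in> Obj C \<Longrightarrow> F_arr X X (Idt C X) = Idt D (F X)"
    and F_Comp:
      "\<lbrakk>X \<in> Obj C; Y \<in> Obj C; Z \<in> Obj C; f \<in> Hom C X Y; g \<in> Hom C Y Z\<rbrakk>
       \<Longrightarrow> F_arr X Z (Comp C X Y Z g f)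
         = Comp D (F Z) (F Y) (F X) (F_arr X Y f) (F_arr Y Z g)"


section \<open>Algebras over the base field\<close>

definition char_zero :: "('k, 'z) ring_scheme \<Rightarrow> bool"
  where "char_zero k \<longleftrightarrow> (\<forall>n::nat. n > 0 \<longrightarrow> [n] \<cdot>\<^bsub>k\<^esub> \<one>\<^bsub>k\<^esub> \<noteq> \<zero>\<^bsub>k\<^esub>)"

definition alg_hom ::
    "('k, 'z) ring_scheme \<Rightarrow> ('k, 'm, 'x) module_scheme \<Rightarrow> ('k, 'n, 'y) module_scheme \<Rightarrow> ('m \<Rightarrow> 'n) set"
  where "alg_hom k M N =
    {f \<in> ring_hom M N. \<forall>c \<in> carrier k. \<forall>x \<in> carrier M. f (c \<odot>\<^bsub>M\<^esub> x) = c \<odot>\<^bsub>N\<^esub> f x}"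


section \<open>Tensor products over the base algebra\<close>

text \<open>
  An \<open>A\<close>-bimodule that is at the same time a \<open>k\<close>-algebra; \<^term>\<open>lact M a x\<close> is \<open>a\<cdot>x\<close>
  and \<^term>\<open>ract M x a\<close> is \<open>x\<cdot>a\<close>.
\<close>

record ('k, 'a, 'm) bimodule = "('k, 'm) module" +
  lact :: "'a \<Rightarrow> 'm \<Rightarrow> 'm"
  ract :: "'m \<Rightarrow> 'a \<Rightarrow> 'm"

definition bimod_hom ::
    "('a, 'z) ring_scheme \<Rightarrow> ('k, 'a, 'm, 'x) bimodule_scheme \<Rightarrow> ('k, 'a, 'n, 'y) bimodule_scheme
      \<Rightarrow> ('m \<Rightarrow> 'n) set"
  where "bimod_hom A M N =
    {f \<in> carrier M \<rightarrow> carrier N.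
       (\<forall>x \<in> carrier M. \<forall>y \<in> carrier M. f (x \<oplus>\<^bsub>M\<^esub> y) = f x \<oplus>\<^bsub>N\<^esub> f y) \<and>
       (\<forall>a \<in> carrier A. \<forall>x \<in> carrier M. f (lact M a x) = lact N a (f x)) \<and>
       (\<forall>a \<in> carrier A. \<forall>x \<in> carrier M. f (ract M x a) = ract N (f x) a)}"

definition regular_bimod :: "('k, 'a, 'z) module_scheme \<Rightarrow> ('k, 'a, 'a) bimodule"
  where "regular_bimod A =
    \<lparr>carrier = carrier A, monoid.mult = (\<otimes>\<^bsub>A\<^esub>), monoid.one = \<one>\<^bsub>A\<^esub>, ring.zero = \<zero>\<^bsub>A\<^esub>, ring.add = (\<oplus>\<^bsub>A\<^esub>),
     smult = (\<odot>\<^bsub>A\<^esub>), lact = (\<otimes>\<^bsub>A\<^esub>), ract = (\<otimes>\<^bsub>A\<^esub>)\<rparr>"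

text \<open>
  \<open>M \<otimes>\<^sub>A N\<close> is the free abelian group on \<open>M \<times> N\<close> modulo the subgroup generated by the
  biadditivity relations and by \<open>(m\<cdot>a, n) - (m, a\<cdot>n)\<close>; its elements are cosets.
\<close>

type_synonym ('m, 'n) tensor = "(('m \<times> 'n) \<Rightarrow>\<^sub>0 int) set"

definition tensor_rels ::
    "('a, 'z) ring_scheme \<Rightarrow> ('k, 'a, 'm, 'x) bimodule_scheme \<Rightarrow> ('k, 'a, 'n, 'y) bimodule_scheme
      \<Rightarrow> (('m \<times> 'n) \<Rightarrow>\<^sub>0 int) set"
  where "tensor_rels A M N =
    {frag_of (m \<oplus>\<^bsub>M\<^esub> m', n) - frag_of (m, n) - frag_of (m', n) | m m' n.
       m \<in> carrier M \<and> m' \<in> carrier M \<and> n \<in> carrier N} \<union>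
    {frag_of (m, n \<oplus>\<^bsub>N\<^esub> n') - frag_of (m, n) - frag_of (m, n') | m n n'.
       m \<in> carrier M \<and> n \<in> carrier N \<and> n' \<in> carrier N} \<union>
    {frag_of (ract M m a, n) - frag_of (m, lact N a n) | m a n.
       m \<in> carrier M \<and> a \<in> carrier A \<and> n \<in> carrier N}"

definition tensor_null ::
    "('a, 'z) ring_scheme \<Rightarrow> ('k, 'a, 'm, 'x) bimodule_scheme \<Rightarrow> ('k, 'a, 'n, 'y) bimodule_scheme
      \<Rightarrow> (('m \<times> 'n) \<Rightarrow>\<^sub>0 int) set"
  where "tensor_null A M N =
    generate (free_Abelian_group (carrier M \<times> carrier N)) (tensor_rels A M N)"

definition pure ::
    "('a, 'z) ring_scheme \<Rightarrow> ('k, 'a, 'm, 'x) bimodule_scheme \<Rightarrow> ('k, 'a, 'n, 'y) bimodule_scheme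
      \<Rightarrow> 'm \<Rightarrow> 'n \<Rightarrow> ('m, 'n) tensor"
  where "pure A M N m n =
    tensor_null A M N #>\<^bsub>free_Abelian_group (carrier M \<times> carrier N)\<^esub> frag_of (m, n)"

text \<open>
  The underlying abelian group of \<open>M \<otimes>\<^sub>A N\<close> in additive notation. The multiplicative fields
  are irrelevant here; \<open>tensor\<close> below supplies them.
\<close>

definition tensor_group ::
    "('a, 'z) ring_scheme \<Rightarrow> ('k, 'a, 'm, 'x) bimodule_scheme \<Rightarrow> ('k, 'a, 'n, 'y) bimodule_scheme
      \<Rightarrow> ('m, 'n) tensor ring"
  where "tensor_group A M N =
    (let Q = free_Abelian_group (carrier M \<times> carrier N) Mod tensor_null A M N
     in \<lparr>carrier = carrier Q, monoid.mult = undefined, monoid.one = undefined,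
         ring.zero = \<one>\<^bsub>Q\<^esub>, ring.add = (\<otimes>\<^bsub>Q\<^esub>)\<rparr>)"

text \<open>
  The additive map \<open>M \<otimes>\<^sub>A N \<rightarrow> B\<close> with \<open>m \<otimes> n \<mapsto> f (m, n)\<close>. For a biadditive and \<open>A\<close>-balanced
  \<open>f\<close> the value does not depend on the representative \<open>p\<close> of the coset, so the image below is a
  singleton; \<open>tensor_lift\<close> is used for such \<open>f\<close> only. In Sweedler notation,
  \<open>f (u\<^sub>1, u\<^sub>2)\<close> is the lift of \<open>f\<close> at \<open>\<Delta> u\<close>.
\<close>

definition tensor_lift :: "('b, 'z) ring_scheme \<Rightarrow> ('m \<times> 'n \<Rightarrow> 'b) \<Rightarrow> ('m, 'n) tensor \<Rightarrow> 'b"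
  where "tensor_lift B f z =
    the_elem ((\<lambda>p. \<Oplus>\<^bsub>B\<^esub>x \<in> Poly_Mapping.keys p. [Poly_Mapping.lookup p x] \<cdot>\<^bsub>B\<^esub> f x) ` z)"

definition tensor ::
    "('a, 'z) ring_scheme \<Rightarrow> ('k, 'a, 'm, 'x) bimodule_scheme \<Rightarrow> ('k, 'a, 'n, 'y) bimodule_scheme
      \<Rightarrow> ('k, 'a, ('m, 'n) tensor) bimodule"
  where "tensor A M N =
    (let T = tensor_group A M N; p = pure A M N
     in \<lparr>carrier = carrier T,
         monoid.mult = (\<lambda>z w. tensor_lift T (\<lambda>(m, n).
           tensor_lift T (\<lambda>(m', n'). p (m \<otimes>\<^bsub>M\<^esub> m') (n \<otimes>\<^bsub>N\<^esub> n')) w) z),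
         monoid.one = p \<one>\<^bsub>M\<^esub> \<one>\<^bsub>N\<^esub>,
         ring.zero = \<zero>\<^bsub>T\<^esub>,
         ring.add = (\<oplus>\<^bsub>T\<^esub>),
         smult = (\<lambda>c. tensor_lift T (\<lambda>(m, n). p (c \<odot>\<^bsub>M\<^esub> m) n)),
         lact = (\<lambda>a. tensor_lift T (\<lambda>(m, n). p (lact M a m) n)),
         ract = (\<lambda>z a. tensor_lift T (\<lambda>(m, n). p m (ract N n a)) z)\<rparr>)"

text \<open>The map \<open>f \<otimes>\<^sub>A g\<close> into \<open>M \<otimes>\<^sub>A N\<close>.\<close>

definition tensor_map ::
    "('a, 'z) ring_scheme \<Rightarrow> ('k, 'a, 'm, 'x) bimodule_scheme \<Rightarrow> ('k, 'a, 'n, 'y) bimodule_scheme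
      \<Rightarrow> ('p \<Rightarrow> 'm) \<Rightarrow> ('q \<Rightarrow> 'n) \<Rightarrow> ('p, 'q) tensor \<Rightarrow> ('m, 'n) tensor"
  where "tensor_map A M N f g = tensor_lift (tensor A M N) (\<lambda>(x, y). pure A M N (f x) (g y))"

text \<open>The associativity isomorphism \<open>(M \<otimes>\<^sub>A N) \<otimes>\<^sub>A P \<rightarrow> M \<otimes>\<^sub>A (N \<otimes>\<^sub>A P)\<close>.\<close>

definition tensor_assoc ::
    "('a, 'z) ring_scheme \<Rightarrow> ('k, 'a, 'm, 'x) bimodule_scheme \<Rightarrow> ('k, 'a, 'n, 'y) bimodule_scheme
      \<Rightarrow> ('k, 'a, 'p, 'w) bimodule_scheme
      \<Rightarrow> (('m, 'n) tensor, 'p) tensor \<Rightarrow> ('m, ('n, 'p) tensor) tensor"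
  where "tensor_assoc A M N P =
    (let NP = tensor A N P
     in tensor_lift (tensor A M NP) (\<lambda>(z, w).
          tensor_lift (tensor A M NP) (\<lambda>(u, v). pure A M NP u (pure A N P v w)) z))"


section \<open>Commutative Hopf algebroids\<close>

record ('k, 'a, 'h) hopf_algebroid = "('k, 'h) module" +
  src :: "'a \<Rightarrow> 'h"
  tgt :: "'a \<Rightarrow> 'h"
  comult :: "'h \<Rightarrow> ('h, 'h) tensor"
  counit :: "'h \<Rightarrow> 'a"
  antipode :: "'h \<Rightarrow> 'h"

text \<open>The \<open>A\<close>-bimodule \<open>\<^sub>s\<H>\<^sub>t\<close>.\<close>

definition bimod :: "('k, 'a, 'h) hopf_algebroid \<Rightarrow> ('k, 'a, 'h) bimodule"
  where "bimod H =
    \<lparr>carrier = carrier H, monoid.mult = (\<otimes>\<^bsub>H\<^esub>), monoid.one = \<one>\<^bsub>H\<^esub>, ring.zero = \<zero>\<^bsub>H\<^esub>, ring.add = (\<oplus>\<^bsub>H\<^esub>),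
     smult = (\<odot>\<^bsub>H\<^esub>), lact = (\<lambda>a h. src H a \<otimes>\<^bsub>H\<^esub> h), ract = (\<lambda>h a. h \<otimes>\<^bsub>H\<^esub> tgt H a)\<rparr>"

definition tensor_sq ::
    "('k, 'a) module \<Rightarrow> ('k, 'a, 'h) hopf_algebroid \<Rightarrow> ('k, 'a, ('h, 'h) tensor) bimodule"
  where "tensor_sq A H = tensor A (bimod H) (bimod H)"

locale comm_hopf_algebroid =
  fixes k :: "'k ring" and A :: "('k, 'a) module" and H :: "('k, 'a, 'h) hopf_algebroid"
  assumes base_algebra: "algebra k A"
    and total_algebra: "algebra k H"
    and src_hom: "src H \<in> alg_hom k A H"
    and tgt_hom: "tgt H \<in> alg_hom k A H"
    and comult_hom: "comult H \<in> alg_hom k H (tensor_sq A H)"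
    and comult_bimod_hom: "comult H \<in> bimod_hom A (bimod H) (tensor_sq A H)"
    and counit_hom: "counit H \<in> alg_hom k H A"
    and counit_bimod_hom: "counit H \<in> bimod_hom A (bimod H) (regular_bimod A)"
    and coassoc: "u \<in> carrier H \<Longrightarrow>
      tensor_assoc A (bimod H) (bimod H) (bimod H)
        (tensor_map A (tensor_sq A H) (bimod H) (comult H) (\<lambda>x. x) (comult H u)) =
      tensor_map A (bimod H) (tensor_sq A H) (\<lambda>x. x) (comult H) (comult H u)"
    and counit_left: "u \<in> carrier H \<Longrightarrow>
      tensor_lift H (\<lambda>(x, y). lact (bimod H) (counit H x) y) (comult H u) = u"
    and counit_right: "u \<in> carrier H \<Longrightarrow>
      tensor_lift H (\<lambda>(x, y). ract (bimod H) x (counit H y)) (comult H u) = u"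
    and antipode_hom: "antipode H \<in> alg_hom k H H"
    and antipode_src: "a \<in> carrier A \<Longrightarrow> antipode H (src H a) = tgt H a"
    and antipode_tgt: "a \<in> carrier A \<Longrightarrow> antipode H (tgt H a) = src H a"
    and antipode_invol: "u \<in> carrier H \<Longrightarrow> antipode H (antipode H u) = u"
    and antipode_left: "u \<in> carrier H \<Longrightarrow>
      tensor_lift H (\<lambda>(x, y). antipode H x \<otimes>\<^bsub>H\<^esub> y) (comult H u) = tgt H (counit H u)"
    and antipode_right: "u \<in> carrier H \<Longrightarrow>
      tensor_lift H (\<lambda>(x, y). x \<otimes>\<^bsub>H\<^esub> antipode H y) (comult H u) = src H (counit H u)"

text \<open>Maps are extensional (\<open>undefined\<close> off the carrier), so that equal morphisms are equal terms.\<close>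

definition hopf_hom ::
    "'k ring \<Rightarrow> ('k, 'a) module \<Rightarrow> ('k, 'a, 'h) hopf_algebroid \<Rightarrow> ('k, 'a, 'g) hopf_algebroid
      \<Rightarrow> ('h \<Rightarrow> 'g) set"
  where "hopf_hom k A H K =
    {\<phi> \<in> alg_hom k H K \<inter> extensional (carrier H).
       (\<forall>a \<in> carrier A. \<phi> (src H a) = src K a) \<and>
       (\<forall>a \<in> carrier A. \<phi> (tgt H a) = tgt K a) \<and>
       (\<forall>u \<in> carrier H. comult K (\<phi> u) = tensor_map A (bimod K) (bimod K) \<phi> \<phi> (comult H u)) \<and>
       (\<forall>u \<in> carrier H. counit K (\<phi> u) = counit H u) \<and>
       (\<forall>u \<in> carrier H. antipode K (\<phi> u) = \<phi> (antipode H u))}"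

definition CHAlgd ::
    "'k ring \<Rightarrow> ('k, 'a) module \<Rightarrow> (('k, 'a, 'h) hopf_algebroid, 'h \<Rightarrow> 'h) category"
  where "CHAlgd k A =
    \<lparr>Obj = {H. comm_hopf_algebroid k A H},
     Hom = hopf_hom k A,
     Idt = (\<lambda>H. \<lambda>u \<in> carrier H. u),
     Comp = (\<lambda>H K L \<psi> \<phi>. compose (carrier H) \<psi> \<phi>)\<rparr>"


section \<open>Lie-Rinehart algebras\<close>

text \<open>
  The fields \<open>mult\<close> and \<open>one\<close> inherited from \<^typ>\<open>('k, 'l) module\<close> play no role in a module
  and are left unconstrained.
\<close>

record ('k, 'l) lie_algebra = "('k, 'l) module" +
  lie :: "'l \<Rightarrow> 'l \<Rightarrow> 'l"

record ('k, 'a, 'l) lie_module = "('k, 'l) lie_algebra" +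
  asmult :: "'a \<Rightarrow> 'l \<Rightarrow> 'l"

record ('k, 'a, 'l) lie_rinehart = "('k, 'a, 'l) lie_module" +
  anchor :: "'l \<Rightarrow> 'a \<Rightarrow> 'a"

locale lie_algebra = module k L
  for k :: "'k ring" and L :: "('k, 'l, 'z) lie_algebra_scheme" +
  assumes lie_closed: "\<lbrakk>X \<in> carrier L; Y \<in> carrier L\<rbrakk> \<Longrightarrow> lie L X Y \<in> carrier L"
    and lie_add_left: "\<lbrakk>X \<in> carrier L; Y \<in> carrier L; Z \<in> carrier L\<rbrakk> \<Longrightarrow>
      lie L (X \<oplus>\<^bsub>L\<^esub> Y) Z = lie L X Z \<oplus>\<^bsub>L\<^esub> lie L Y Z"
    and lie_add_right: "\<lbrakk>X \<in> carrier L; Y \<in> carrier L; Z \<in> carrier L\<rbrakk> \<Longrightarrow>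
      lie L X (Y \<oplus>\<^bsub>L\<^esub> Z) = lie L X Y \<oplus>\<^bsub>L\<^esub> lie L X Z"
    and lie_smult_left: "\<lbrakk>c \<in> carrier k; X \<in> carrier L; Y \<in> carrier L\<rbrakk> \<Longrightarrow>
      lie L (c \<odot>\<^bsub>L\<^esub> X) Y = c \<odot>\<^bsub>L\<^esub> lie L X Y"
    and lie_smult_right: "\<lbrakk>c \<in> carrier k; X \<in> carrier L; Y \<in> carrier L\<rbrakk> \<Longrightarrow>
      lie L X (c \<odot>\<^bsub>L\<^esub> Y) = c \<odot>\<^bsub>L\<^esub> lie L X Y"
    and lie_alternating: "X \<in> carrier L \<Longrightarrow> lie L X X = \<zero>\<^bsub>L\<^esub>"
    and jacobi: "\<lbrakk>X \<in> carrier L; Y \<in> carrier L; Z \<in> carrier L\<rbrakk> \<Longrightarrow>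
      lie L X (lie L Y Z) \<oplus>\<^bsub>L\<^esub> lie L Y (lie L Z X) \<oplus>\<^bsub>L\<^esub> lie L Z (lie L X Y) = \<zero>\<^bsub>L\<^esub>"

text \<open>The \<open>A\<close>-module underlying \<open>L\<close>.\<close>

definition amod :: "('k, 'a, 'l, 'z) lie_module_scheme \<Rightarrow> ('a, 'l) module"
  where "amod L =
    \<lparr>carrier = carrier L, monoid.mult = (\<otimes>\<^bsub>L\<^esub>), monoid.one = \<one>\<^bsub>L\<^esub>, ring.zero = \<zero>\<^bsub>L\<^esub>, ring.add = (\<oplus>\<^bsub>L\<^esub>),
     smult = asmult L\<rparr>"

definition lie_module_hom ::
    "'k ring \<Rightarrow> ('k, 'a) module \<Rightarrow> ('k, 'a, 'l, 'x) lie_module_scheme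
      \<Rightarrow> ('k, 'a, 'm, 'y) lie_module_scheme \<Rightarrow> ('l \<Rightarrow> 'm) set"
  where "lie_module_hom k A L M =
    {f \<in> carrier L \<rightarrow> carrier M.
       (\<forall>X \<in> carrier L. \<forall>Y \<in> carrier L. f (X \<oplus>\<^bsub>L\<^esub> Y) = f X \<oplus>\<^bsub>M\<^esub> f Y) \<and>
       (\<forall>c \<in> carrier k. \<forall>X \<in> carrier L. f (c \<odot>\<^bsub>L\<^esub> X) = c \<odot>\<^bsub>M\<^esub> f X) \<and>
       (\<forall>a \<in> carrier A. \<forall>X \<in> carrier L. f (asmult L a X) = asmult M a (f X)) \<and>
       (\<forall>X \<in> carrier L. \<forall>Y \<in> carrier L. f (lie L X Y) = lie M (f X) (f Y))}"

definition derivations :: "'k ring \<Rightarrow> ('k, 'a) module \<Rightarrow> ('a \<Rightarrow> 'a) set"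
  where "derivations k A =
    {D \<in> carrier A \<rightarrow>\<^sub>E carrier A.
       (\<forall>a \<in> carrier A. \<forall>b \<in> carrier A. D (a \<oplus>\<^bsub>A\<^esub> b) = D a \<oplus>\<^bsub>A\<^esub> D b) \<and>
       (\<forall>c \<in> carrier k. \<forall>a \<in> carrier A. D (c \<odot>\<^bsub>A\<^esub> a) = c \<odot>\<^bsub>A\<^esub> D a) \<and>
       (\<forall>a \<in> carrier A. \<forall>b \<in> carrier A.
          D (a \<otimes>\<^bsub>A\<^esub> b) = a \<otimes>\<^bsub>A\<^esub> D b \<oplus>\<^bsub>A\<^esub> D a \<otimes>\<^bsub>A\<^esub> b)}"

definition Der :: "'k ring \<Rightarrow> ('k, 'a) module \<Rightarrow> ('k, 'a, 'a \<Rightarrow> 'a) lie_module"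
  where "Der k A =
    \<lparr>carrier = derivations k A,
     monoid.mult = undefined,
     monoid.one = undefined,
     ring.zero = (\<lambda>b \<in> carrier A. \<zero>\<^bsub>A\<^esub>),
     ring.add = (\<lambda>D E. \<lambda>b \<in> carrier A. D b \<oplus>\<^bsub>A\<^esub> E b),
     smult = (\<lambda>c D. \<lambda>b \<in> carrier A. c \<odot>\<^bsub>A\<^esub> D b),
     lie = (\<lambda>D E. \<lambda>b \<in> carrier A. D (E b) \<ominus>\<^bsub>A\<^esub> E (D b)),
     asmult = (\<lambda>a D. \<lambda>b \<in> carrier A. a \<otimes>\<^bsub>A\<^esub> D b)\<rparr>"

text \<open>
  \<open>smult_asmult\<close> says that \<open>k\<close> acts on the \<open>A\<close>-module \<open>L\<close> through \<open>k \<rightarrow> A\<close>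
  (take \<open>a = 1\<close>).
\<close>

locale lie_rinehart =
  fixes k :: "'k ring" and A :: "('k, 'a) module" and L :: "('k, 'a, 'l) lie_rinehart"
  assumes base_algebra: "algebra k A"
    and lie_algebra: "lie_algebra k L"
    and amod: "module A (amod L)"
    and smult_asmult: "\<lbrakk>c \<in> carrier k; a \<in> carrier A; X \<in> carrier L\<rbrakk> \<Longrightarrow>
      asmult L (c \<odot>\<^bsub>A\<^esub> a) X = c \<odot>\<^bsub>L\<^esub> asmult L a X"
    and anchor_hom: "anchor L \<in> lie_module_hom k A L (Der k A)"
    and lie_asmult: "\<lbrakk>a \<in> carrier A; X \<in> carrier L; Y \<in> carrier L\<rbrakk> \<Longrightarrow>
      lie L X (asmult L a Y) = asmult L a (lie L X Y) \<oplus>\<^bsub>L\<^esub> asmult L (anchor L X a) Y"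

definition lie_rinehart_hom ::
    "'k ring \<Rightarrow> ('k, 'a) module \<Rightarrow> ('k, 'a, 'l) lie_rinehart \<Rightarrow> ('k, 'a, 'm) lie_rinehart
      \<Rightarrow> ('l \<Rightarrow> 'm) set"
  where "lie_rinehart_hom k A L M =
    {f \<in> lie_module_hom k A L M \<inter> extensional (carrier L).
       \<forall>X \<in> carrier L. anchor M (f X) = anchor L X}"

definition LieRin ::
    "'k ring \<Rightarrow> ('k, 'a) module \<Rightarrow> (('k, 'a, 'l) lie_rinehart, 'l \<Rightarrow> 'l) category"
  where "LieRin k A =
    \<lparr>Obj = {L. lie_rinehart k A L},
     Hom = lie_rinehart_hom k A,
     Idt = (\<lambda>L. \<lambda>X \<in> carrier L. X),
     Comp = (\<lambda>L M N g f. compose (carrier L) g f)\<rparr>"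


section \<open>The Lie-Rinehart algebra of a commutative Hopf algebroid\<close>

text \<open>\<open>Der\<^sub>k\<^sup>s(\<H>, A\<^sub>\<epsilon>)\<close>\<close>

definition src_derivations ::
    "'k ring \<Rightarrow> ('k, 'a) module \<Rightarrow> ('k, 'a, 'h) hopf_algebroid \<Rightarrow> ('h \<Rightarrow> 'a) set"
  where "src_derivations k A H =
    {\<delta> \<in> carrier H \<rightarrow>\<^sub>E carrier A.
       (\<forall>u \<in> carrier H. \<forall>v \<in> carrier H. \<delta> (u \<oplus>\<^bsub>H\<^esub> v) = \<delta> u \<oplus>\<^bsub>A\<^esub> \<delta> v) \<and>
       (\<forall>c \<in> carrier k. \<forall>u \<in> carrier H. \<delta> (c \<odot>\<^bsub>H\<^esub> u) = c \<odot>\<^bsub>A\<^esub> \<delta> u) \<and>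
       (\<forall>a \<in> carrier A. \<delta> (src H a) = \<zero>\<^bsub>A\<^esub>) \<and>
       (\<forall>u \<in> carrier H. \<forall>v \<in> carrier H.
          \<delta> (u \<otimes>\<^bsub>H\<^esub> v) = counit H u \<otimes>\<^bsub>A\<^esub> \<delta> v \<oplus>\<^bsub>A\<^esub> \<delta> u \<otimes>\<^bsub>A\<^esub> counit H v)}"

text \<open>\<open>u \<mapsto> \<delta> (u\<^sub>1 t(\<delta>' u\<^sub>2))\<close>\<close>

definition convolve ::
    "('k, 'a) module \<Rightarrow> ('k, 'a, 'h) hopf_algebroid \<Rightarrow> ('h \<Rightarrow> 'a) \<Rightarrow> ('h \<Rightarrow> 'a) \<Rightarrow> 'h \<Rightarrow> 'a"
  where "convolve A H \<delta> \<delta>' u =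
    tensor_lift A (\<lambda>(x, y). \<delta> (x \<otimes>\<^bsub>H\<^esub> tgt H (\<delta>' y))) (comult H u)"

definition Lie_of ::
    "'k ring \<Rightarrow> ('k, 'a) module \<Rightarrow> ('k, 'a, 'h) hopf_algebroid \<Rightarrow> ('k, 'a, 'h \<Rightarrow> 'a) lie_rinehart"
  where "Lie_of k A H =
    \<lparr>carrier = src_derivations k A H,
     monoid.mult = undefined,
     monoid.one = undefined,
     ring.zero = (\<lambda>u \<in> carrier H. \<zero>\<^bsub>A\<^esub>),
     ring.add = (\<lambda>\<delta> \<delta>'. \<lambda>u \<in> carrier H. \<delta> u \<oplus>\<^bsub>A\<^esub> \<delta>' u),
     smult = (\<lambda>c \<delta>. \<lambda>u \<in> carrier H. c \<odot>\<^bsub>A\<^esub> \<delta> u),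
     lie = (\<lambda>\<delta> \<delta>'. \<lambda>u \<in> carrier H. convolve A H \<delta> \<delta>' u \<ominus>\<^bsub>A\<^esub> convolve A H \<delta>' \<delta> u),
     asmult = (\<lambda>a \<delta>. \<lambda>u \<in> carrier H. a \<otimes>\<^bsub>A\<^esub> \<delta> u),
     anchor = (\<lambda>\<delta>. compose (carrier A) \<delta> (tgt H))\<rparr>"

definition Lie_of_arr ::
    "'k ring \<Rightarrow> ('k, 'a) module \<Rightarrow> ('k, 'a, 'h) hopf_algebroid \<Rightarrow> ('k, 'a, 'g) hopf_algebroid
      \<Rightarrow> ('h \<Rightarrow> 'g) \<Rightarrow> ('g \<Rightarrow> 'a) \<Rightarrow> ('h \<Rightarrow> 'a)"
  where "Lie_of_arr k A H K \<phi> = (\<lambda>\<delta> \<in> carrier (Lie_of k A K). compose (carrier H) \<delta> \<phi>)"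

end

theory Submission
  imports Defs
begin

text \<open>
  Call a map \<open>f : \<H> \<rightarrow> A\<close> left linear if it is additive and
  \<open>f (s(a) u) = a f(u)\<close>. For left linear \<open>f, g\<close> the map \<open>(x, y) \<mapsto> f (x t(g y))\<close> is
  \<open>A\<close>-balanced, so it factors through \<open>\<H> \<otimes>\<^sub>A \<H>\<close>, and
  \<open>(f * g)(u) = f (u\<^sub>1 t(g u\<^sub>2))\<close> is again left linear. Coassociativity makes \<open>*\<close>
  associative (\<open>convolve_assoc\<close>) and counitality makes \<open>\<epsilon>\<close> its unit
  (\<open>convolve_counit_left\<close>, \<open>convolve_counit_right\<close>): the left linear functionals form an
  associative \<open>k\<close>-algebra, a kind of dual of the coring \<open>\<H>\<close>. The elements of
  \<open>Der\<^sub>k\<^sup>s(\<H>, A\<^sub>\<epsilon>)\<close> are left linear, and their bracket is the commutator of \<open>*\<close>,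
  which is why it is bilinear and alternating and satisfies the Jacobi identity.

  A product \<open>\<delta> * \<delta>'\<close> of derivations is in general not a derivation. Because \<open>\<Delta>\<close> is multiplicative,
  \<open>(\<delta> * \<delta>')(u v)\<close> expands into
  \<open>\<epsilon>(u) (\<delta> * \<delta>')(v) + \<delta>(u) \<delta>'(v) + \<delta>'(u) \<delta>(v) + (\<delta> * \<delta>')(u) \<epsilon>(v)\<close> (\<open>convolve_mult\<close>). The
  two middle terms are symmetric in \<open>\<delta>\<close> and \<open>\<delta>'\<close>, so the commutator is a derivation
  (\<open>src_derivations_bracket_closed\<close>).

  The remaining axioms come from evaluating \<open>*\<close> at special places. Since
  \<open>\<Delta>(t b) = 1 \<otimes> t b\<close>, one has \<open>(f * g)(t b) = f (t (g (t b)))\<close> (\<open>convolve_at_tgt\<close>), so the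
  anchor \<open>\<delta> \<mapsto> \<delta> \<circ> t\<close> preserves brackets. Applying the Leibniz rule of \<open>\<delta>\<close> to
  \<open>\<delta> (u\<^sub>1 t(\<delta>' u\<^sub>2) t(a))\<close> gives \<open>\<delta> * (a \<delta>') = a (\<delta> * \<delta>') + \<delta>(t a) \<delta>'\<close>
  (\<open>convolve_asmult_right\<close>), which is the Lie-Rinehart identity. Finally a morphism of Hopf
  algebroids \<open>\<phi>\<close> commutes with \<open>\<Delta>\<close> and \<open>t\<close>, so precomposition with \<open>\<phi>\<close> preserves \<open>*\<close>
  (\<open>convolve_compose\<close>) and all the rest of the structure.

  The foundation is the universal property of the concrete coset model of
  \<open>M \<otimes>\<^sub>A N\<close>. Its working form is \<open>tensor_lift_unique\<close>: an additive map that takes the values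
  \<open>f (m, n)\<close> on pure tensors is \<open>tensor_lift B f\<close>. Identities between lifts are proved by
  exhibiting one side as an additive map and computing it on pure tensors; \<open>tensor_universal\<close>
  provides such maps for balanced \<open>f\<close>.
\<close>

section \<open>Maps out of the balanced tensor product\<close>

text \<open>
  The sum on the right is the one by which \<open>tensor_lift\<close> evaluates a representative; thus any
  additive map out of a tensor product, pulled back to the free abelian group, is computed by it.
\<close>

lemma hom_free_Abelian_group_expansion:
  assumes B: "abelian_group B"
    and h: "h \<in> hom (free_Abelian_group S) (add_monoid B)"
    and p: "Poly_Mapping.keys p \<subseteq> S"
  shows "h p = (\<Oplus>\<^bsub>B\<^esub>x \<in> Poly_Mapping.keys p. [Poly_Mapping.lookup p x] \<cdot>\<^bsub>B\<^esub> h (frag_of x))"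
proof -
  interpret abelian_group B by (rule B)
  interpret h: group_hom "free_Abelian_group S" "add_monoid B" h
    using h add.group_axioms by (simp add: group_hom_def group_hom_axioms_def a_group)
  have hc: "h (frag_of x) \<in> carrier B" if "x \<in> S" for x
    using that h.hom_closed[of "frag_of x"] by simp
  have hmul: "h (frag_cmul c (frag_of x)) = [c] \<cdot>\<^bsub>B\<^esub> h (frag_of x)" if "x \<in> S" for c x
    using that h.hom_int_pow[of "frag_of x" c] by (simp add: add_pow_def)
  have "h (\<Sum>x\<in>I. frag_cmul (c x) (frag_of x)) = (\<Oplus>\<^bsub>B\<^esub>x\<in>I. [c x] \<cdot>\<^bsub>B\<^esub> h (frag_of x))"
    if "finite I" "I \<subseteq> S" for I and c :: "_ \<Rightarrow> int"
    using that
  proof (induction I rule: finite_induct)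
    case empty
    then show ?case using h.hom_one by simp
  next
    case (insert x I)
    have "(\<Sum>x\<in>I. frag_cmul (c x) (frag_of x)) \<in> carrier (free_Abelian_group S)"
      by (rule sum_closed_free_Abelian_group)
        (use insert.prems in \<open>auto dest!: subsetD[OF keys_cmul]\<close>)
    moreover have "frag_cmul (c x) (frag_of x) \<in> carrier (free_Abelian_group S)"
      using insert.prems by (auto dest!: subsetD[OF keys_cmul])
    ultimately have "h (frag_cmul (c x) (frag_of x) + (\<Sum>x\<in>I. frag_cmul (c x) (frag_of x)))
       = h (frag_cmul (c x) (frag_of x)) \<oplus>\<^bsub>B\<^esub> h (\<Sum>x\<in>I. frag_cmul (c x) (frag_of x))"
      using h.hom_mult by fastforce
    then show ?case
      using insert hmul hc by (simp add: finsum_insert Pi_iff subset_iff)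
  qed
  from this[OF finite_keys p, of "Poly_Mapping.lookup p"] show ?thesis
    using frag_expansion[of p] by (simp add: frag_extend_def)
qed

lemma tensor_lift_cong_group:
  assumes "carrier B = carrier B'" "ring.add B = ring.add B'" "ring.zero B = ring.zero B'"
  shows "tensor_lift B = tensor_lift B'"
  using assms
  unfolding tensor_lift_def finsum_def add_pow_def finprod_def int_pow_def nat_pow_def m_inv_def
  by (simp add: Let_def cong: if_cong)

text \<open>
  The axioms are chosen to be stable under \<open>\<otimes>\<^sub>A\<close>: additivity and closure make the relations of
  \<open>M \<otimes>\<^sub>A N\<close> meaningful, and the commutation law makes the two outer actions on \<open>M \<otimes>\<^sub>A N\<close>
  well defined. Iterated tensor products therefore fall under the same locale.
\<close>

locale commuting_actions = abelian_group M
  for A :: "('a, 'z) ring_scheme" and M :: "('k, 'a, 'm, 'x) bimodule_scheme" +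
  assumes lact_hom: "a \<in> carrier A \<Longrightarrow> lact M a \<in> hom (add_monoid M) (add_monoid M)"
    and ract_hom: "a \<in> carrier A \<Longrightarrow> (\<lambda>x. ract M x a) \<in> hom (add_monoid M) (add_monoid M)"
    and lact_ract: "\<lbrakk>a \<in> carrier A; b \<in> carrier A; x \<in> carrier M\<rbrakk> \<Longrightarrow>
      lact M a (ract M x b) = ract M (lact M a x) b"
begin

lemma lact_closed: "\<lbrakk>a \<in> carrier A; x \<in> carrier M\<rbrakk> \<Longrightarrow> lact M a x \<in> carrier M"
  using lact_hom by (auto simp: hom_def)

lemma ract_closed: "\<lbrakk>a \<in> carrier A; x \<in> carrier M\<rbrakk> \<Longrightarrow> ract M x a \<in> carrier M"
  using ract_hom by (auto simp: hom_def)

end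

definition balanced ::
    "('a, 'z) ring_scheme \<Rightarrow> ('k, 'a, 'm, 'x) bimodule_scheme \<Rightarrow> ('k, 'a, 'n, 'y) bimodule_scheme
      \<Rightarrow> ('b, 'w) ring_scheme \<Rightarrow> ('m \<times> 'n \<Rightarrow> 'b) \<Rightarrow> bool"
  where "balanced A M N B f \<longleftrightarrow>
    (\<forall>n \<in> carrier N. (\<lambda>m. f (m, n)) \<in> hom (add_monoid M) (add_monoid B)) \<and>
    (\<forall>m \<in> carrier M. (\<lambda>n. f (m, n)) \<in> hom (add_monoid N) (add_monoid B)) \<and>
    (\<forall>m \<in> carrier M. \<forall>a \<in> carrier A. \<forall>n \<in> carrier N. f (ract M m a, n) = f (m, lact N a n))"

lemma balancedD:
  assumes "balanced A M N B f"
  shows "n \<in> carrier N \<Longrightarrow> (\<lambda>m. f (m, n)) \<in> hom (add_monoid M) (add_monoid B)"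
    and "m \<in> carrier M \<Longrightarrow> (\<lambda>n. f (m, n)) \<in> hom (add_monoid N) (add_monoid B)"
    and "\<lbrakk>m \<in> carrier M; a \<in> carrier A; n \<in> carrier N\<rbrakk> \<Longrightarrow> f (ract M m a, n) = f (m, lact N a n)"
    and "\<lbrakk>m \<in> carrier M; n \<in> carrier N\<rbrakk> \<Longrightarrow> f (m, n) \<in> carrier B"
  using assms by (auto simp: balanced_def hom_def)

lemma balanced_hom:
  assumes "balanced A M N B f" "h \<in> hom (add_monoid B) (add_monoid C)"
  shows "balanced A M N C (\<lambda>x. h (f x))"
  using assms by (auto simp: balanced_def hom_def Pi_iff)

text \<open>
  Only the inner actions, right on \<open>M\<close> and left on \<open>N\<close>, have to be respected. This covers the
  outer actions on \<open>M \<otimes>\<^sub>A N\<close> and multiplication by fixed elements of \<open>\<H>\<close>, none of which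
  need be maps of bimodules.
\<close>

lemma balanced_factors:
  assumes "balanced A M' N' B f"
    and "\<phi> \<in> hom (add_monoid M) (add_monoid M')" "\<psi> \<in> hom (add_monoid N) (add_monoid N')"
    and "\<And>a m. \<lbrakk>a \<in> carrier A; m \<in> carrier M\<rbrakk> \<Longrightarrow> \<phi> (ract M m a) = ract M' (\<phi> m) a"
    and "\<And>a n. \<lbrakk>a \<in> carrier A; n \<in> carrier N\<rbrakk> \<Longrightarrow> \<psi> (lact N a n) = lact N' a (\<psi> n)"
  shows "balanced A M N B (\<lambda>(m, n). f (\<phi> m, \<psi> n))"
  using assms by (auto simp: balanced_def hom_def Pi_iff)

lemma bimod_hom_is_hom: "f \<in> bimod_hom A M N \<Longrightarrow> f \<in> hom (add_monoid M) (add_monoid N)"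
  by (auto simp: bimod_hom_def hom_def)

lemma balanced_bimod_hom:
  assumes "balanced A M' N' B f" "\<phi> \<in> bimod_hom A M M'" "\<psi> \<in> bimod_hom A N N'"
  shows "balanced A M N B (\<lambda>(m, n). f (\<phi> m, \<psi> n))"
  by (rule balanced_factors[OF assms(1) assms(2,3)[THEN bimod_hom_is_hom]])
    (use assms(2,3) in \<open>auto simp: bimod_hom_def\<close>)

lemma id_bimod_hom: "(\<lambda>x. x) \<in> bimod_hom A M M"
  by (auto simp: bimod_hom_def)

lemma balanced_add:
  assumes B: "abelian_group B" and "balanced A M N B f" "balanced A M N B g"
  shows "balanced A M N B (\<lambda>x. f x \<oplus>\<^bsub>B\<^esub> g x)"
proof -
  interpret B: abelian_group B by (rule B)
  show ?thesis
    using assms(2,3) by (auto simp: balanced_def hom_def Pi_iff B.a_ac)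
qed

lemma balanced_minus:
  assumes B: "abelian_group B" and "balanced A M N B f" "balanced A M N B g"
  shows "balanced A M N B (\<lambda>x. f x \<ominus>\<^bsub>B\<^esub> g x)"
proof -
  interpret B: abelian_group B by (rule B)
  show ?thesis
    using assms(2,3) by (auto simp: balanced_def hom_def Pi_iff a_minus_def B.minus_add B.a_ac)
qed

locale tensor_factors = M: commuting_actions A M + N: commuting_actions A N
  for A :: "('a, 'z) ring_scheme" and M :: "('k, 'a, 'm, 'x) bimodule_scheme"
    and N :: "('k, 'a, 'n, 'y) bimodule_scheme"
begin

abbreviation (input) F where "F \<equiv> free_Abelian_group (carrier M \<times> carrier N)"
abbreviation (input) R where "R \<equiv> tensor_null A M N"
abbreviation (input) T where "T \<equiv> tensor A M N"

sublocale F: comm_group F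
  by (rule abelian_free_Abelian_group)

lemma tensor_rels_subset: "tensor_rels A M N \<subseteq> carrier F"
proof -
  have "\<And>x y z. \<lbrakk>x \<in> carrier F; y \<in> carrier F; z \<in> carrier F\<rbrakk> \<Longrightarrow> x - y - z \<in> carrier F"
    and "\<And>x y. \<lbrakk>x \<in> carrier F; y \<in> carrier F\<rbrakk> \<Longrightarrow> x - y \<in> carrier F"
    by (auto dest!: subsetD[OF keys_diff])
  then show ?thesis
    unfolding tensor_rels_def
    by (auto simp del: carrier_free_Abelian_group_iff
        simp: M.ract_closed N.lact_closed)
qed

lemma tensor_null_normal: "R \<lhd> F"
  unfolding tensor_null_def
  by (intro F.subgroup_imp_normal F.generate_is_subgroup tensor_rels_subset)

sublocale R: normal R F
  by (rule tensor_null_normal)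

lemma tensor_group_simps:
  "carrier (tensor_group A M N) = carrier T" "ring.add (tensor_group A M N) = ring.add T"
  "ring.zero (tensor_group A M N) = ring.zero T"
  by (simp_all add: tensor_def Let_def)

lemma tensor_simps:
  "carrier T = carrier (F Mod R)" "ring.add T = monoid.mult (F Mod R)" "ring.zero T = monoid.one (F Mod R)"
  by (simp_all add: tensor_def tensor_group_def Let_def)

lemma carrier_tensor: "carrier T = (\<lambda>p. R #>\<^bsub>F\<^esub> p) ` carrier F"
  unfolding tensor_simps by (rule carrier_FactGroup)

lemma hom_into_tensor: "hom G (add_monoid T) = hom G (F Mod R)"
  unfolding hom_def by (simp add: tensor_simps)

lemma hom_from_tensor: "hom (add_monoid T) G = hom (F Mod R) G"
  unfolding hom_def by (simp add: tensor_simps)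

lemma abelian_group_tensor: "abelian_group T"
proof -
  interpret Q: comm_group "F Mod R"
    by (rule F.abelian_FactGroup) (rule R.subgroup_axioms)
  show ?thesis
    by (rule abelian_groupI; unfold tensor_simps)
      (fact Q.m_closed Q.one_closed Q.m_assoc Q.m_comm Q.l_one | erule Q.l_inv_ex)+
qed

text \<open>
  The multiplication and the actions of \<open>tensor\<close> are lifts into the bare group \<open>tensor_group\<close>; this
  restates them as lifts into the bimodule, to which the universal property applies.
\<close>

lemma tensor_lift_into_tensor: "tensor_lift (tensor_group A M N) = tensor_lift T"
  by (rule tensor_lift_cong_group) (simp_all only: tensor_group_simps)

lemma coset_hom: "(\<lambda>p. R #>\<^bsub>F\<^esub> p) \<in> hom F (add_monoid T)"
  unfolding hom_into_tensor by (rule R.r_coset_hom_Mod)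

text \<open>
  \<open>h\<close> pulls back to a homomorphism on the free abelian group, which evaluates every
  representative of \<open>z\<close> by the expansion above; so the image in the definition of
  \<open>tensor_lift\<close> is the singleton of \<open>h z\<close>. The mere existence of \<open>h\<close> forces the lift to be well
  defined.
\<close>

lemma tensor_lift_unique:
  assumes B: "abelian_group B"
    and h: "h \<in> hom (add_monoid T) (add_monoid B)"
    and pure: "\<And>m n. \<lbrakk>m \<in> carrier M; n \<in> carrier N\<rbrakk> \<Longrightarrow> h (pure A M N m n) = f (m, n)"
    and z: "z \<in> carrier T"
  shows "tensor_lift B f z = h z"
proof -
  have hom: "(\<lambda>p. h (R #>\<^bsub>F\<^esub> p)) \<in> hom F (add_monoid B)"
    using hom_compose[OF coset_hom h] by (simp add: comp_def)
  obtain p\<^sub>0 where p0: "p\<^sub>0 \<in> carrier F" "z = R #>\<^bsub>F\<^esub> p\<^sub>0"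
    using z by (auto simp: carrier_tensor)
  have "(\<Oplus>\<^bsub>B\<^esub>x \<in> Poly_Mapping.keys p. [Poly_Mapping.lookup p x] \<cdot>\<^bsub>B\<^esub> f x) = h z" if "p \<in> z" for p
  proof -
    have p: "p \<in> carrier F" and zp: "z = R #>\<^bsub>F\<^esub> p"
      using that p0 R.subset R.subgroup_axioms
      by (auto dest: F.r_coset_subset_G F.repr_independence simp del: carrier_free_Abelian_group_iff)
    have "h z = (\<Oplus>\<^bsub>B\<^esub>x \<in> Poly_Mapping.keys p. [Poly_Mapping.lookup p x] \<cdot>\<^bsub>B\<^esub> h (R #>\<^bsub>F\<^esub> frag_of x))"
      unfolding zp by (rule hom_free_Abelian_group_expansion[OF B hom]) (use p in simp)
    also have "\<dots> = (\<Oplus>\<^bsub>B\<^esub>x \<in> Poly_Mapping.keys p. [Poly_Mapping.lookup p x] \<cdot>\<^bsub>B\<^esub> f x)"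
    proof (rule abelian_monoid.finsum_cong')
      fix x assume "x \<in> Poly_Mapping.keys p"
      then obtain m n where x: "x = (m, n)" "m \<in> carrier M" "n \<in> carrier N"
        using p by auto
      then show "[Poly_Mapping.lookup p x] \<cdot>\<^bsub>B\<^esub> h (R #>\<^bsub>F\<^esub> frag_of x) = [Poly_Mapping.lookup p x] \<cdot>\<^bsub>B\<^esub> f x"
        using pure[of m n] by (simp add: pure_def)
    next
      have "f x \<in> carrier B" if x: "x \<in> Poly_Mapping.keys p" for x
      proof -
        obtain m n where mn: "x = (m, n)" "m \<in> carrier M" "n \<in> carrier N"
          using p x by auto
        then have "frag_of x \<in> carrier F" by simp
        from hom_in_carrier[OF hom this] show ?thesis
          using mn pure[of m n] by (simp add: pure_def)
      qed
      then show "(\<lambda>x. [Poly_Mapping.lookup p x] \<cdot>\<^bsub>B\<^esub> f x) \<in> Poly_Mapping.keys p \<rightarrow> carrier B"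
        using abelian_group.a_group[OF B] group.int_pow_closed[of "add_monoid B"]
        by (auto simp: add_pow_def)
    qed (use B in \<open>auto simp: abelian_group_def\<close>)
    finally show ?thesis by simp
  qed
  moreover have "p\<^sub>0 \<in> z"
    using p0 F.rcos_self R.subgroup_axioms by blast
  ultimately have "(\<lambda>p. \<Oplus>\<^bsub>B\<^esub>x \<in> Poly_Mapping.keys p. [Poly_Mapping.lookup p x] \<cdot>\<^bsub>B\<^esub> f x) ` z = {h z}"
    by auto
  then show ?thesis
    by (simp add: tensor_lift_def)
qed

lemma pure_closed: "\<lbrakk>m \<in> carrier M; n \<in> carrier N\<rbrakk> \<Longrightarrow> pure A M N m n \<in> carrier T"
  unfolding carrier_tensor pure_def by (rule imageI) simp

text \<open>
  The three kinds of relations express biadditivity and balancedness of \<open>f\<close>, so the homomorphism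
  extending \<open>f\<close> to the free abelian group kills the subgroup that they generate.
\<close>

lemma tensor_universal:
  assumes B: "abelian_group B" and f: "balanced A M N B f"
  obtains h where "h \<in> hom (add_monoid T) (add_monoid B)"
    "\<And>m n. \<lbrakk>m \<in> carrier M; n \<in> carrier N\<rbrakk> \<Longrightarrow> h (pure A M N m n) = f (m, n)"
proof -
  interpret B: abelian_group B by (rule B)
  have fc: "f ` (carrier M \<times> carrier N) \<subseteq> carrier (add_monoid B)"
    using f by (auto simp: balanced_def hom_def)
  obtain g where g: "g \<in> hom F (add_monoid B)"
    and gf: "\<And>x. x \<in> carrier M \<times> carrier N \<Longrightarrow> g (frag_of x) = f x"
    using comm_group.free_Abelian_group_universal[OF B.a_comm_group fc] by blast
  interpret g: group_hom F "add_monoid B" g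
    using g by (simp add: group_hom_def group_hom_axioms_def B.a_group)
  have diff: "g (x - y) = g x \<ominus>\<^bsub>B\<^esub> g y" if "x \<in> carrier F" "y \<in> carrier F" for x y
  proof -
    have "g (x \<otimes>\<^bsub>F\<^esub> inv\<^bsub>F\<^esub> y) = g x \<ominus>\<^bsub>B\<^esub> g y"
      using that g.hom_mult[of x "inv\<^bsub>F\<^esub> y"] g.hom_inv[of y]
      by (simp add: a_minus_def a_inv_def del: carrier_free_Abelian_group_iff inv_free_Abelian_group
          mult_free_Abelian_group)
    with that show ?thesis by simp
  qed
  have keysdiff: "x - y \<in> carrier F" if "x \<in> carrier F" "y \<in> carrier F" for x y
    using that by (auto dest!: subsetD[OF keys_diff])
  have frag: "frag_of (m, n) \<in> carrier F" if "m \<in> carrier M" "n \<in> carrier N" for m n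
    using that by simp
  have fcl: "f (m, n) \<in> carrier B" if "m \<in> carrier M" "n \<in> carrier N" for m n
    using that fc by auto
  have gfmn: "g (frag_of (m, n)) = f (m, n)" if "m \<in> carrier M" "n \<in> carrier N" for m n
    using that gf by simp
  have cancel: "(x \<oplus>\<^bsub>B\<^esub> y) \<ominus>\<^bsub>B\<^esub> x \<ominus>\<^bsub>B\<^esub> y = \<zero>\<^bsub>B\<^esub>" if "x \<in> carrier B" "y \<in> carrier B" for x y
    using that B.r_neg[of "x \<oplus>\<^bsub>B\<^esub> y"] by (simp add: a_minus_def B.minus_add B.a_assoc)
  have cancel': "x \<ominus>\<^bsub>B\<^esub> x = \<zero>\<^bsub>B\<^esub>" if "x \<in> carrier B" for x
    using that B.r_neg[of x] by (simp add: a_minus_def)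
  have "tensor_rels A M N \<subseteq> kernel F (add_monoid B) g"
    using tensor_rels_subset f
    unfolding tensor_rels_def balanced_def hom_def kernel_def
    by (auto simp: diff keysdiff frag gfmn fcl cancel cancel' M.ract_closed N.lact_closed
        simp del: carrier_free_Abelian_group_iff)
  then have R: "R \<subseteq> kernel F (add_monoid B) g"
    unfolding tensor_null_def by (rule F.generate_subgroup_incl[OF _ g.subgroup_kernel])
  obtain h where h: "h \<in> hom (F Mod R) (add_monoid B)"
    and hg: "\<And>x. x \<in> carrier F \<Longrightarrow> h (R #>\<^bsub>F\<^esub> x) = g x"
    using g.FactGroup_universal_kernel[OF tensor_null_normal R] by blast
  show thesis
  proof
    show "h \<in> hom (add_monoid T) (add_monoid B)"
      unfolding hom_from_tensor by (rule h)
    show "h (pure A M N m n) = f (m, n)" if "m \<in> carrier M" "n \<in> carrier N" for m n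
      unfolding pure_def using that frag gfmn hg by simp
  qed
qed

lemma tensor_lift_hom:
  assumes B: "abelian_group B" and f: "balanced A M N B f"
  shows "tensor_lift B f \<in> hom (add_monoid T) (add_monoid B)"
proof -
  interpret T: abelian_group T by (rule abelian_group_tensor)
  obtain h where h: "h \<in> hom (add_monoid T) (add_monoid B)"
    "\<And>m n. \<lbrakk>m \<in> carrier M; n \<in> carrier N\<rbrakk> \<Longrightarrow> h (pure A M N m n) = f (m, n)"
    using tensor_universal[OF assms] by blast
  then have "tensor_lift B f z = h z" if "z \<in> carrier T" for z
    by (rule tensor_lift_unique[OF B]) (use that in auto)
  then show ?thesis
    by (intro group.hom_eq[OF T.a_group h(1)]) auto
qed

lemma tensor_lift_pure:
  assumes B: "abelian_group B" and f: "balanced A M N B f"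
    and "m \<in> carrier M" "n \<in> carrier N"
  shows "tensor_lift B f (pure A M N m n) = f (m, n)"
proof -
  obtain h where h: "h \<in> hom (add_monoid T) (add_monoid B)"
    "\<And>m n. \<lbrakk>m \<in> carrier M; n \<in> carrier N\<rbrakk> \<Longrightarrow> h (pure A M N m n) = f (m, n)"
    using tensor_universal[OF B f] by blast
  then have "tensor_lift B f (pure A M N m n) = h (pure A M N m n)"
    by (rule tensor_lift_unique[OF B]) (use assms pure_closed in auto)
  with h assms show ?thesis by simp
qed

lemma pure_balanced: "balanced A M N T (\<lambda>(m, n). pure A M N m n)"
proof -
  interpret T: abelian_group T by (rule abelian_group_tensor)
  interpret c: group_hom F "add_monoid T" "\<lambda>p. R #>\<^bsub>F\<^esub> p"
    using coset_hom by (simp add: group_hom_def group_hom_axioms_def T.a_group)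
  have eq: "R #>\<^bsub>F\<^esub> x = R #>\<^bsub>F\<^esub> y"
    if "x \<in> carrier F" "y \<in> carrier F" "x - y \<in> tensor_rels A M N" for x y
  proof -
    have "x - y \<in> R" unfolding tensor_null_def by (rule generate.incl) fact
    then have "x \<in> R #>\<^bsub>F\<^esub> y" unfolding r_coset_def by (auto intro!: bexI[of _ "x - y"])
    with that show ?thesis
      using F.repr_independence R.subgroup_axioms by metis
  qed
  have plus: "R #>\<^bsub>F\<^esub> (x + y) = (R #>\<^bsub>F\<^esub> x) \<oplus>\<^bsub>T\<^esub> (R #>\<^bsub>F\<^esub> y)"
    if "x \<in> carrier F" "y \<in> carrier F" for x y
    using c.hom_mult[OF that] by simp
  have frag: "frag_of (m, n) \<in> carrier F" if "m \<in> carrier M" "n \<in> carrier N" for m n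
    using that by simp
  have sum: "x + y \<in> carrier F" if "x \<in> carrier F" "y \<in> carrier F" for x y
    using that by (auto dest!: subsetD[OF keys_add])
  have 1: "pure A M N (m \<oplus>\<^bsub>M\<^esub> m') n = pure A M N m n \<oplus>\<^bsub>T\<^esub> pure A M N m' n"
    if "m \<in> carrier M" "m' \<in> carrier M" "n \<in> carrier N" for m m' n
  proof -
    have "frag_of (m \<oplus>\<^bsub>M\<^esub> m', n) - (frag_of (m, n) + frag_of (m', n)) \<in> tensor_rels A M N"
      unfolding diff_add_eq_diff_diff_swap tensor_rels_def using that
      by (auto simp: algebra_simps)
    then show ?thesis
      unfolding pure_def
      by (subst plus[symmetric], use that in \<open>simp_all only: frag\<close>, intro eq)
        (use that in \<open>auto intro!: frag sum simp del: carrier_free_Abelian_group_iff\<close>)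
  qed
  have 2: "pure A M N m (n \<oplus>\<^bsub>N\<^esub> n') = pure A M N m n \<oplus>\<^bsub>T\<^esub> pure A M N m n'"
    if "m \<in> carrier M" "n \<in> carrier N" "n' \<in> carrier N" for m n n'
  proof -
    have "frag_of (m, n \<oplus>\<^bsub>N\<^esub> n') - (frag_of (m, n) + frag_of (m, n')) \<in> tensor_rels A M N"
      unfolding diff_add_eq_diff_diff_swap tensor_rels_def using that
      by (auto simp: algebra_simps)
    then show ?thesis
      unfolding pure_def
      by (subst plus[symmetric], use that in \<open>simp_all only: frag\<close>, intro eq)
        (use that in \<open>auto intro!: frag sum simp del: carrier_free_Abelian_group_iff\<close>)
  qed
  have 3: "pure A M N (ract M m a) n = pure A M N m (lact N a n)"
    if "m \<in> carrier M" "a \<in> carrier A" "n \<in> carrier N" for m a n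
    unfolding pure_def
    by (rule eq) (use that in \<open>auto intro!: frag simp: M.ract_closed N.lact_closed tensor_rels_def simp del: carrier_free_Abelian_group_iff\<close>)
  from 1 2 3 show ?thesis
    by (auto simp: balanced_def hom_def pure_closed)
qed

lemma tensor_eqI:
  assumes B: "abelian_group B"
    and h: "h \<in> hom (add_monoid T) (add_monoid B)" and g: "g \<in> hom (add_monoid T) (add_monoid B)"
    and eq: "\<And>m n. \<lbrakk>m \<in> carrier M; n \<in> carrier N\<rbrakk> \<Longrightarrow> h (pure A M N m n) = g (pure A M N m n)"
    and z: "z \<in> carrier T"
  shows "h z = g z"
  using tensor_lift_unique[OF B h _ z, of "\<lambda>(m, n). g (pure A M N m n)"]
    tensor_lift_unique[OF B g _ z, of "\<lambda>(m, n). g (pure A M N m n)"] eq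
  by simp

lemma tensor_lift_closed:
  assumes "abelian_group B" "balanced A M N B f" "z \<in> carrier T"
  shows "tensor_lift B f z \<in> carrier B"
  using tensor_lift_hom[OF assms(1,2)] assms(3) by (auto simp: hom_def)

lemma tensor_lift_cong:
  assumes B: "abelian_group B" and f: "balanced A M N B f" and z: "z \<in> carrier T"
    and "\<And>m n. \<lbrakk>m \<in> carrier M; n \<in> carrier N\<rbrakk> \<Longrightarrow> f (m, n) = g (m, n)"
  shows "tensor_lift B f z = tensor_lift B g z"
  by (rule sym, rule tensor_lift_unique[OF B tensor_lift_hom[OF B f] _ z])
    (use assms tensor_lift_pure[OF B f] in auto)

lemma hom_tensor_lift:
  assumes B: "abelian_group B" and C: "abelian_group C"
    and f: "balanced A M N B f" and h: "h \<in> hom (add_monoid B) (add_monoid C)"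
    and z: "z \<in> carrier T"
  shows "h (tensor_lift B f z) = tensor_lift C (\<lambda>x. h (f x)) z"
  by (rule sym, rule tensor_lift_unique[OF C _ _ z, of "\<lambda>z. h (tensor_lift B f z)"])
    (use tensor_lift_pure[OF B f] hom_compose[OF tensor_lift_hom[OF B f] h] in \<open>auto simp: comp_def\<close>)

lemma tensor_lift_add:
  assumes B: "abelian_group B" and f: "balanced A M N B f" and g: "balanced A M N B g"
    and z: "z \<in> carrier T"
  shows "tensor_lift B (\<lambda>x. f x \<oplus>\<^bsub>B\<^esub> g x) z = tensor_lift B f z \<oplus>\<^bsub>B\<^esub> tensor_lift B g z"
proof -
  interpret B: abelian_group B by (rule B)
  have "(\<lambda>z. tensor_lift B f z \<oplus>\<^bsub>B\<^esub> tensor_lift B g z) \<in> hom (add_monoid T) (add_monoid B)"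
    using tensor_lift_hom[OF B f] tensor_lift_hom[OF B g]
    by (auto simp: hom_def Pi_iff B.a_ac)
  then show ?thesis
    by (rule tensor_lift_unique[OF B _ _ z]) (simp add: tensor_lift_pure[OF B] f g)
qed

lemma tensor_lift_minus:
  assumes B: "abelian_group B" and f: "balanced A M N B f" and g: "balanced A M N B g"
    and z: "z \<in> carrier T"
  shows "tensor_lift B (\<lambda>x. f x \<ominus>\<^bsub>B\<^esub> g x) z = tensor_lift B f z \<ominus>\<^bsub>B\<^esub> tensor_lift B g z"
proof -
  interpret B: abelian_group B by (rule B)
  have "(\<lambda>z. tensor_lift B f z \<ominus>\<^bsub>B\<^esub> tensor_lift B g z) \<in> hom (add_monoid T) (add_monoid B)"
    using tensor_lift_hom[OF B f] tensor_lift_hom[OF B g]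
    by (auto simp: hom_def Pi_iff a_minus_def B.minus_add B.a_ac)
  then show ?thesis
    by (rule tensor_lift_unique[OF B _ _ z]) (simp add: tensor_lift_pure[OF B] f g)
qed

text \<open>
  Lifting in one pair of variables keeps balancedness in the other pair. It is used for the product
  of \<open>\<H> \<otimes>\<^sub>A \<H>\<close>, a lift in each of its two arguments.
\<close>

lemma balanced_tensor_lift_param:
  assumes B: "abelian_group B"
    and f: "\<And>p. p \<in> carrier M' \<times> carrier N' \<Longrightarrow> balanced A M N B (f p)"
    and g: "\<And>q. q \<in> carrier M \<times> carrier N \<Longrightarrow> balanced A M' N' B (\<lambda>p. f p q)"
    and M': "commuting_actions A M'" and N': "commuting_actions A N'"
    and w: "w \<in> carrier T"
  shows "balanced A M' N' B (\<lambda>p. tensor_lift B (f p) w)"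
proof -
  interpret M': commuting_actions A M' by (rule M')
  interpret N': commuting_actions A N' by (rule N')
  have add: "tensor_lift B (f p) w = tensor_lift B (f p') w \<oplus>\<^bsub>B\<^esub> tensor_lift B (f p'') w"
    if "p \<in> carrier M' \<times> carrier N'" "p' \<in> carrier M' \<times> carrier N'" "p'' \<in> carrier M' \<times> carrier N'"
      and eq: "\<And>q. q \<in> carrier M \<times> carrier N \<Longrightarrow> f p q = f p' q \<oplus>\<^bsub>B\<^esub> f p'' q" for p p' p''
  proof -
    have "tensor_lift B (f p) w = tensor_lift B (\<lambda>q. f p' q \<oplus>\<^bsub>B\<^esub> f p'' q) w"
      by (rule tensor_lift_cong[OF B f w]) (use that in auto)
    with that show ?thesis by (simp only: tensor_lift_add[OF B f f w])
  qed
  have "tensor_lift B (f (m \<oplus>\<^bsub>M'\<^esub> m', n)) w = tensor_lift B (f (m, n)) w \<oplus>\<^bsub>B\<^esub> tensor_lift B (f (m', n)) w"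
    if "m \<in> carrier M'" "m' \<in> carrier M'" "n \<in> carrier N'" for m m' n
    by (rule add) (use that balancedD(1)[OF g] in \<open>auto simp: hom_def\<close>)
  moreover have "tensor_lift B (f (m, n \<oplus>\<^bsub>N'\<^esub> n')) w = tensor_lift B (f (m, n)) w \<oplus>\<^bsub>B\<^esub> tensor_lift B (f (m, n')) w"
    if "m \<in> carrier M'" "n \<in> carrier N'" "n' \<in> carrier N'" for m n n'
    by (rule add) (use that balancedD(2)[OF g] in \<open>auto simp: hom_def\<close>)
  moreover have "tensor_lift B (f (ract M' m a, n)) w = tensor_lift B (f (m, lact N' a n)) w"
    if "m \<in> carrier M'" "n \<in> carrier N'" "a \<in> carrier A" for m n a
    by (rule tensor_lift_cong[OF B f w])
      (use that balancedD(3)[OF g] in \<open>auto simp: M'.ract_closed\<close>)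
  ultimately show ?thesis
    using tensor_lift_closed[OF B f w] by (auto simp: balanced_def hom_def)
qed

end

section \<open>The bimodule structure, functoriality and associativity of the tensor product\<close>

context tensor_factors
begin

lemma lact_tensor: "lact T a = tensor_lift T (\<lambda>(m, n). pure A M N (lact M a m) n)"
  unfolding tensor_lift_into_tensor[symmetric] by (simp add: tensor_def Let_def)

lemma ract_tensor: "ract T z a = tensor_lift T (\<lambda>(m, n). pure A M N m (ract N n a)) z"
  unfolding tensor_lift_into_tensor[symmetric] by (simp add: tensor_def Let_def)

lemma lact_tensor_balanced:
  assumes a: "a \<in> carrier A"
  shows "balanced A M N T (\<lambda>(m, n). pure A M N (lact M a m) n)"
  using balanced_factors[OF pure_balanced M.lact_hom[OF a] iso_imp_homomorphism[OF iso_set_refl]]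
    M.lact_ract[OF a] by (simp add: balanced_factors)

lemma ract_tensor_balanced:
  assumes a: "a \<in> carrier A"
  shows "balanced A M N T (\<lambda>(m, n). pure A M N m (ract N n a))"
  using balanced_factors[OF pure_balanced iso_imp_homomorphism[OF iso_set_refl] N.ract_hom[OF a]]
    N.lact_ract[OF _ a] by simp

lemma lact_pure:
  "\<lbrakk>a \<in> carrier A; m \<in> carrier M; n \<in> carrier N\<rbrakk> \<Longrightarrow>
    lact T a (pure A M N m n) = pure A M N (lact M a m) n"
  by (simp add: lact_tensor tensor_lift_pure[OF abelian_group_tensor lact_tensor_balanced])

lemma ract_pure:
  "\<lbrakk>a \<in> carrier A; m \<in> carrier M; n \<in> carrier N\<rbrakk> \<Longrightarrow>
    ract T (pure A M N m n) a = pure A M N m (ract N n a)"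
  by (simp add: ract_tensor tensor_lift_pure[OF abelian_group_tensor ract_tensor_balanced])

lemma commuting_actions_tensor: "commuting_actions A T"
proof -
  interpret T: abelian_group T by (rule abelian_group_tensor)
  have l: "lact T a \<in> hom (add_monoid T) (add_monoid T)" if "a \<in> carrier A" for a
    unfolding lact_tensor
    by (rule tensor_lift_hom[OF T.abelian_group_axioms lact_tensor_balanced[OF that]])
  have r: "(\<lambda>z. ract T z a) \<in> hom (add_monoid T) (add_monoid T)" if "a \<in> carrier A" for a
    using tensor_lift_hom[OF T.abelian_group_axioms ract_tensor_balanced[OF that]]
    unfolding ract_tensor by (simp add: eta_contract_eq)
  show ?thesis
  proof unfold_locales
    fix a b z
    assume a: "a \<in> carrier A" and b: "b \<in> carrier A" and z: "z \<in> carrier T"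
    have "(\<lambda>z. lact T a (ract T z b)) \<in> hom (add_monoid T) (add_monoid T)"
      and "(\<lambda>z. ract T (lact T a z) b) \<in> hom (add_monoid T) (add_monoid T)"
      using hom_compose[OF r[OF b] l[OF a]] hom_compose[OF l[OF a] r[OF b]] by (simp_all add: comp_def)
    then show "lact T a (ract T z b) = ract T (lact T a z) b"
      by (rule tensor_eqI[OF T.abelian_group_axioms _ _ _ z])
        (simp add: a b lact_pure ract_pure M.lact_closed N.ract_closed)
  qed (use l r in auto)
qed

lemma tensor_lift_lact:
  assumes B: "abelian_group B" and f: "balanced A M N B f"
    and a: "a \<in> carrier A" and z: "z \<in> carrier T"
  shows "tensor_lift B f (lact T a z) = tensor_lift B (\<lambda>(m, n). f (lact M a m, n)) z"
proof -
  interpret T: commuting_actions A T by (rule commuting_actions_tensor)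
  have "(\<lambda>z. tensor_lift B f (lact T a z)) \<in> hom (add_monoid T) (add_monoid B)"
    using hom_compose[OF T.lact_hom[OF a] tensor_lift_hom[OF B f]] by (simp add: comp_def)
  then show ?thesis
    by (rule sym[OF tensor_lift_unique[OF B _ _ z]])
      (simp add: lact_pure tensor_lift_pure[OF B f] a M.lact_closed)
qed

lemma tensor_lift_ract:
  assumes B: "abelian_group B" and f: "balanced A M N B f"
    and a: "a \<in> carrier A" and z: "z \<in> carrier T"
  shows "tensor_lift B f (ract T z a) = tensor_lift B (\<lambda>(m, n). f (m, ract N n a)) z"
proof -
  interpret T: commuting_actions A T by (rule commuting_actions_tensor)
  have "(\<lambda>z. tensor_lift B f (ract T z a)) \<in> hom (add_monoid T) (add_monoid B)"
    using hom_compose[OF T.ract_hom[OF a] tensor_lift_hom[OF B f]] by (simp add: comp_def)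
  then show ?thesis
    by (rule sym[OF tensor_lift_unique[OF B _ _ z]])
      (simp add: ract_pure tensor_lift_pure[OF B f] a N.ract_closed)
qed

text \<open>
  A function of three variables that is balanced at both places where \<open>\<otimes>\<^sub>A\<close> occurs descends to
  \<open>(M \<otimes>\<^sub>A N) \<otimes>\<^sub>A P\<close>.
\<close>

lemma balanced_tensor_lift:
  assumes B: "abelian_group B" and P: "commuting_actions A P"
    and f: "\<And>w. w \<in> carrier P \<Longrightarrow> balanced A M N B (f w)"
    and add: "\<And>m n. \<lbrakk>m \<in> carrier M; n \<in> carrier N\<rbrakk> \<Longrightarrow>
      (\<lambda>w. f w (m, n)) \<in> hom (add_monoid P) (add_monoid B)"
    and bal: "\<And>a m n w. \<lbrakk>a \<in> carrier A; m \<in> carrier M; n \<in> carrier N; w \<in> carrier P\<rbrakk> \<Longrightarrow>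
      f w (m, ract N n a) = f (lact P a w) (m, n)"
  shows "balanced A T P B (\<lambda>(z, w). tensor_lift B (f w) z)"
proof -
  interpret P: commuting_actions A P by (rule P)
  interpret B: abelian_group B by (rule B)
  have 1: "tensor_lift B (f (w \<oplus>\<^bsub>P\<^esub> w')) z = tensor_lift B (f w) z \<oplus>\<^bsub>B\<^esub> tensor_lift B (f w') z"
    if "w \<in> carrier P" "w' \<in> carrier P" "z \<in> carrier T" for w w' z
  proof -
    have "tensor_lift B (f (w \<oplus>\<^bsub>P\<^esub> w')) z = tensor_lift B (\<lambda>x. f w x \<oplus>\<^bsub>B\<^esub> f w' x) z"
      by (rule tensor_lift_cong[OF B f])
        (use that add in \<open>auto simp: hom_def\<close>)
    with that show ?thesis by (simp add: tensor_lift_add B f)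
  qed
  have 2: "tensor_lift B (f w) (ract T z a) = tensor_lift B (f (lact P a w)) z"
    if "a \<in> carrier A" "z \<in> carrier T" "w \<in> carrier P" for a w z
  proof -
    have "tensor_lift B (f w) (ract T z a) = tensor_lift B (\<lambda>(m, n). f w (m, ract N n a)) z"
      using that by (simp add: tensor_lift_ract B f)
    also have "\<dots> = tensor_lift B (f (lact P a w)) z"
      by (rule sym, rule tensor_lift_cong[OF B f]) (use that bal in \<open>auto simp: P.lact_closed\<close>)
    finally show ?thesis .
  qed
  show ?thesis
    unfolding balanced_def
    using 1 2 tensor_lift_hom[OF B f] by (auto simp: hom_def Pi_iff tensor_lift_closed[OF B f])
qed

lemma tensor_map_hom:
  assumes MN': "tensor_factors A M' N'" 
    and "\<phi> \<in> bimod_hom A M M'" "\<psi> \<in> bimod_hom A N N'"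
  shows "tensor_map A M' N' \<phi> \<psi> \<in> hom (add_monoid T) (add_monoid (tensor A M' N'))"
proof -
  interpret T': tensor_factors A M' N' by (rule MN')
  show ?thesis
    unfolding tensor_map_def
    by (rule tensor_lift_hom[OF T'.abelian_group_tensor])
      (use balanced_bimod_hom[OF T'.pure_balanced assms(2,3)] in simp)
qed

lemma tensor_map_pure:
  assumes MN': "tensor_factors A M' N'"
    and "\<phi> \<in> bimod_hom A M M'" "\<psi> \<in> bimod_hom A N N'" "m \<in> carrier M" "n \<in> carrier N"
  shows "tensor_map A M' N' \<phi> \<psi> (pure A M N m n) = pure A M' N' (\<phi> m) (\<psi> n)"
proof -
  interpret T': tensor_factors A M' N' by (rule MN')
  show ?thesis
    unfolding tensor_map_def
    by (subst tensor_lift_pure[OF T'.abelian_group_tensor])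
      (use balanced_bimod_hom[OF T'.pure_balanced assms(2,3)] assms in simp_all)
qed

lemma tensor_lift_tensor_map:
  assumes MN': "tensor_factors A M' N'" and B: "abelian_group B"
    and \<phi>: "\<phi> \<in> bimod_hom A M M'" and \<psi>: "\<psi> \<in> bimod_hom A N N'"
    and f: "balanced A M' N' B f" and z: "z \<in> carrier T"
  shows "tensor_lift B f (tensor_map A M' N' \<phi> \<psi> z) = tensor_lift B (\<lambda>(m, n). f (\<phi> m, \<psi> n)) z"
proof -
  interpret T': tensor_factors A M' N' by (rule MN')
  have "(\<lambda>z. tensor_lift B f (tensor_map A M' N' \<phi> \<psi> z)) \<in> hom (add_monoid T) (add_monoid B)"
    using hom_compose[OF tensor_map_hom[OF MN' \<phi> \<psi>] T'.tensor_lift_hom[OF B f]] by (simp add: comp_def)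
  moreover have "\<phi> m \<in> carrier M'" "\<psi> n \<in> carrier N'" if "m \<in> carrier M" "n \<in> carrier N" for m n
    using \<phi> \<psi> that by (auto simp: bimod_hom_def)
  ultimately show ?thesis
    by (intro sym[OF tensor_lift_unique[OF B _ _ z]])
      (simp_all add: tensor_map_pure[OF MN' \<phi> \<psi>] T'.tensor_lift_pure[OF B f])
qed

end

text \<open>
  The associator is a lift of lifts; an additive map commutes with lifts, so it may be
  pushed inside both of them, where only pure tensors remain.
\<close>

lemma tensor_lift_tensor_assoc:
  assumes MN: "tensor_factors A M N" and NP: "tensor_factors A N P"
    and B: "abelian_group B"
    and f: "balanced A M (tensor A N P) B f"
    and z: "z \<in> carrier (tensor A (tensor A M N) P)"
  shows "tensor_lift B f (tensor_assoc A M N P z) =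
    tensor_lift B (\<lambda>(x, w). tensor_lift B (\<lambda>(u, v). f (u, pure A N P v w)) x) z"
proof -
  interpret MN: tensor_factors A M N by (rule MN)
  interpret NP: tensor_factors A N P by (rule NP)
  interpret MN_P: tensor_factors A "tensor A M N" P
    by (intro tensor_factors.intro MN.commuting_actions_tensor NP.N.commuting_actions_axioms)
  interpret M_NP: tensor_factors A M "tensor A N P"
    by (intro tensor_factors.intro NP.commuting_actions_tensor MN.M.commuting_actions_axioms)
  let ?C = "tensor A M (tensor A N P)"
  have slice: "balanced A M N C (\<lambda>(u, v). g (u, pure A N P v w))"
    if g: "balanced A M (tensor A N P) C g" and w: "w \<in> carrier P" for C :: "('t, 's) ring_scheme" and g w
    using g balanced_factors[OF g, of "\<lambda>m. m" M "\<lambda>v. pure A N P v w" N]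
      balancedD(1)[OF NP.pure_balanced w] w by (simp add: NP.lact_pure hom_def)
  have bal: "balanced A (tensor A M N) P C (\<lambda>(x, w). tensor_lift C (\<lambda>(u, v). g (u, pure A N P v w)) x)"
    if C: "abelian_group C" and g: "balanced A M (tensor A N P) C g" for C :: "('t, 's) ring_scheme" and g
  proof (rule MN.balanced_tensor_lift[OF C NP.N.commuting_actions_axioms, where f = "\<lambda>w (u, v). g (u, pure A N P v w)"])
    fix m n assume mn: "m \<in> carrier M" "n \<in> carrier N"
    show "(\<lambda>w. case (m, n) of (u, v) \<Rightarrow> g (u, pure A N P v w)) \<in> hom (add_monoid P) (add_monoid C)"
      using hom_compose[OF balancedD(2)[OF NP.pure_balanced mn(2)] balancedD(2)[OF g mn(1)]]
      by (simp add: comp_def)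
  next
    fix a m n w assume "a \<in> carrier A" "m \<in> carrier M" "n \<in> carrier N" "w \<in> carrier P"
    then show "(case (m, ract N n a) of (u, v) \<Rightarrow> g (u, pure A N P v w))
      = (case (m, n) of (u, v) \<Rightarrow> g (u, pure A N P v (lact P a w)))"
      using balancedD(3)[OF NP.pure_balanced, of n a w] by simp
  qed (rule slice[OF g])
  have C: "abelian_group ?C" by (rule M_NP.abelian_group_tensor)
  let ?assoc = "\<lambda>(x, w). tensor_lift ?C (\<lambda>(u, v). pure A M (tensor A N P) u (pure A N P v w)) x"
  have assoc: "tensor_assoc A M N P = tensor_lift ?C ?assoc"
    by (simp add: tensor_assoc_def Let_def)
  have "balanced A (tensor A M N) P ?C ?assoc"
    using bal[OF C M_NP.pure_balanced] by simp
  then have "tensor_lift B f (tensor_assoc A M N P z)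
      = tensor_lift B (\<lambda>x. tensor_lift B f (?assoc x)) z"
    unfolding assoc using MN_P.hom_tensor_lift[OF C B _ M_NP.tensor_lift_hom[OF B f] z] by blast
  also have "\<dots> = tensor_lift B (\<lambda>(x, w). tensor_lift B (\<lambda>(u, v). f (u, pure A N P v w)) x) z"
  proof (rule sym, rule MN_P.tensor_lift_cong[OF B bal[OF B f] z])
    fix x w assume x: "x \<in> carrier (tensor A M N)" and w: "w \<in> carrier P"
    have "tensor_lift B f (?assoc (x, w)) = tensor_lift B (\<lambda>p. tensor_lift B f ((\<lambda>(u, v). pure A M (tensor A N P) u (pure A N P v w)) p)) x"
      using MN.hom_tensor_lift[OF C B slice[OF M_NP.pure_balanced w] M_NP.tensor_lift_hom[OF B f] x] by simp
    also have "\<dots> = tensor_lift B (\<lambda>(u, v). f (u, pure A N P v w)) x"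
      by (rule sym, rule MN.tensor_lift_cong[OF B slice[OF f w] x])
        (simp add: M_NP.tensor_lift_pure[OF B f] NP.pure_closed w)
    finally show "(case (x, w) of (x, w) \<Rightarrow> tensor_lift B (\<lambda>(u, v). f (u, pure A N P v w)) x)
        = tensor_lift B f (?assoc (x, w))" by simp
  qed
  finally show ?thesis .
qed

section \<open>The convolution product of left linear functionals\<close>

definition left_linear ::
    "('a, 'z) ring_scheme \<Rightarrow> ('k, 'a, 'm, 'x) bimodule_scheme \<Rightarrow> ('m \<Rightarrow> 'a) set"
  where "left_linear A M =
    {f \<in> hom (add_monoid M) (add_monoid A).
       \<forall>a \<in> carrier A. \<forall>x \<in> carrier M. f (lact M a x) = a \<otimes>\<^bsub>A\<^esub> f x}"

lemma bimod_simps [simp]: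
  "carrier (bimod H) = carrier H" "ring.add (bimod H) = ring.add H" "ring.zero (bimod H) = ring.zero H"
  "monoid.mult (bimod H) = monoid.mult H" "monoid.one (bimod H) = monoid.one H"
  "lact (bimod H) a u = src H a \<otimes>\<^bsub>H\<^esub> u" "ract (bimod H) u a = u \<otimes>\<^bsub>H\<^esub> tgt H a"
  by (simp_all add: bimod_def)

context comm_hopf_algebroid
begin

sublocale A: cring A
  using base_algebra by (rule algebra.M_cring)

sublocale H: cring H
  using total_algebra by (rule algebra.M_cring)

abbreviation (input) HH where "HH \<equiv> tensor A (bimod H) (bimod H)"

lemma src_closed [simp]: "a \<in> carrier A \<Longrightarrow> src H a \<in> carrier H"
  and tgt_closed [simp]: "a \<in> carrier A \<Longrightarrow> tgt H a \<in> carrier H"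
  and counit_closed [simp]: "u \<in> carrier H \<Longrightarrow> counit H u \<in> carrier A"
  using src_hom tgt_hom counit_hom by (auto simp: alg_hom_def ring_hom_def)

lemma src_add: "\<lbrakk>a \<in> carrier A; b \<in> carrier A\<rbrakk> \<Longrightarrow> src H (a \<oplus>\<^bsub>A\<^esub> b) = src H a \<oplus>\<^bsub>H\<^esub> src H b"
  and src_mult: "\<lbrakk>a \<in> carrier A; b \<in> carrier A\<rbrakk> \<Longrightarrow> src H (a \<otimes>\<^bsub>A\<^esub> b) = src H a \<otimes>\<^bsub>H\<^esub> src H b"
  and src_one: "src H \<one>\<^bsub>A\<^esub> = \<one>\<^bsub>H\<^esub>"
  and src_smult: "\<lbrakk>c \<in> carrier k; a \<in> carrier A\<rbrakk> \<Longrightarrow> src H (c \<odot>\<^bsub>A\<^esub> a) = c \<odot>\<^bsub>H\<^esub> src H a"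
  using src_hom by (auto simp: alg_hom_def ring_hom_def)

lemma tgt_add: "\<lbrakk>a \<in> carrier A; b \<in> carrier A\<rbrakk> \<Longrightarrow> tgt H (a \<oplus>\<^bsub>A\<^esub> b) = tgt H a \<oplus>\<^bsub>H\<^esub> tgt H b"
  and tgt_mult: "\<lbrakk>a \<in> carrier A; b \<in> carrier A\<rbrakk> \<Longrightarrow> tgt H (a \<otimes>\<^bsub>A\<^esub> b) = tgt H a \<otimes>\<^bsub>H\<^esub> tgt H b"
  and tgt_smult: "\<lbrakk>c \<in> carrier k; a \<in> carrier A\<rbrakk> \<Longrightarrow> tgt H (c \<odot>\<^bsub>A\<^esub> a) = c \<odot>\<^bsub>H\<^esub> tgt H a"
  using tgt_hom by (auto simp: alg_hom_def ring_hom_def)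

lemma counit_add: "\<lbrakk>u \<in> carrier H; v \<in> carrier H\<rbrakk> \<Longrightarrow>
    counit H (u \<oplus>\<^bsub>H\<^esub> v) = counit H u \<oplus>\<^bsub>A\<^esub> counit H v"
  and counit_mult: "\<lbrakk>u \<in> carrier H; v \<in> carrier H\<rbrakk> \<Longrightarrow>
    counit H (u \<otimes>\<^bsub>H\<^esub> v) = counit H u \<otimes>\<^bsub>A\<^esub> counit H v"
  and counit_one: "counit H \<one>\<^bsub>H\<^esub> = \<one>\<^bsub>A\<^esub>"
  using counit_hom by (auto simp: alg_hom_def ring_hom_def)

lemma counit_src [simp]: "a \<in> carrier A \<Longrightarrow> counit H (src H a) = a"
  and counit_tgt [simp]: "a \<in> carrier A \<Longrightarrow> counit H (tgt H a) = a"
proof -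
  assume a: "a \<in> carrier A"
  have "counit H (lact (bimod H) a \<one>\<^bsub>H\<^esub>) = a" "counit H (ract (bimod H) \<one>\<^bsub>H\<^esub> a) = a"
    using counit_bimod_hom a by (simp_all add: bimod_hom_def regular_bimod_def counit_one del: bimod_simps(6,7))
  then show "counit H (src H a) = a" "counit H (tgt H a) = a"
    using a by simp_all
qed

lemma commuting_actions_bimod: "commuting_actions A (bimod H)"
proof (intro commuting_actions.intro commuting_actions_axioms.intro)
  show "abelian_group (bimod H)"
    by (rule abelian_groupI) (auto simp: H.a_ac intro: H.add.l_inv_ex)
qed (auto simp: hom_def H.r_distr H.l_distr H.m_assoc)

sublocale HH: tensor_factors A "bimod H" "bimod H"
  by (intro tensor_factors.intro commuting_actions_bimod)

lemma comult_closed [simp]: "u \<in> carrier H \<Longrightarrow> comult H u \<in> carrier HH"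
  using comult_bimod_hom by (auto simp: bimod_hom_def tensor_sq_def)

lemma comult_hom_add: "comult H \<in> hom (add_monoid H) (add_monoid HH)"
  and comult_src: "\<lbrakk>a \<in> carrier A; u \<in> carrier H\<rbrakk> \<Longrightarrow>
    comult H (src H a \<otimes>\<^bsub>H\<^esub> u) = lact HH a (comult H u)"
  and comult_tgt: "\<lbrakk>a \<in> carrier A; u \<in> carrier H\<rbrakk> \<Longrightarrow>
    comult H (u \<otimes>\<^bsub>H\<^esub> tgt H a) = ract HH (comult H u) a"
  using comult_bimod_hom by (auto simp: bimod_hom_def tensor_sq_def hom_def)

lemma left_linear_hom: "f \<in> left_linear A N \<Longrightarrow> f \<in> hom (add_monoid N) (add_monoid A)"
  and left_linear_closed: "\<lbrakk>f \<in> left_linear A N; x \<in> carrier N\<rbrakk> \<Longrightarrow> f x \<in> carrier A"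
  and left_linear_add: "\<lbrakk>f \<in> left_linear A N; x \<in> carrier N; y \<in> carrier N\<rbrakk> \<Longrightarrow>
    f (x \<oplus>\<^bsub>N\<^esub> y) = f x \<oplus>\<^bsub>A\<^esub> f y"
  and left_linear_lact: "\<lbrakk>f \<in> left_linear A N; a \<in> carrier A; x \<in> carrier N\<rbrakk> \<Longrightarrow>
    f (lact N a x) = a \<otimes>\<^bsub>A\<^esub> f x"
  by (auto simp: left_linear_def hom_def)

lemmas left_linear_bimod =
  left_linear_closed[of _ "bimod H", simplified] left_linear_add[of _ "bimod H", simplified]
  left_linear_lact[of _ "bimod H", simplified]

lemma counit_left_linear: "counit H \<in> left_linear A (bimod H)"
  by (auto simp: left_linear_def hom_def counit_add counit_mult)

lemma mult_hom_add: "a \<in> carrier A \<Longrightarrow> (\<otimes>\<^bsub>A\<^esub>) a \<in> hom (add_monoid A) (add_monoid A)"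
  by (auto simp: hom_def A.r_distr)

text \<open>
  Moving \<open>a\<close> across the tensor sign agrees because \<open>t(a) t(g y) = t(a g(y)) = t(g(a y))\<close>. The
  second factor is an arbitrary \<open>N\<close> so that the lemma also serves \<open>\<H> \<otimes>\<^sub>A (\<H> \<otimes>\<^sub>A \<H>)\<close>.
\<close>

lemma convolution_balanced:
  assumes f: "f \<in> left_linear A (bimod H)" and g: "g \<in> left_linear A N"
    and N: "commuting_actions A N"
  shows "balanced A (bimod H) N A (\<lambda>(x, y). f (x \<otimes>\<^bsub>H\<^esub> tgt H (g y)))"
proof -
  interpret N: commuting_actions A N by (rule N)
  show ?thesis
    using left_linear_bimod[OF f] left_linear_closed[OF g] left_linear_add[OF g] left_linear_lact[OF g]
    by (auto simp: balanced_def hom_def H.l_distr H.r_distr tgt_add tgt_mult H.m_assoc)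
qed

lemma tensor_lift_left_linear:
  assumes f: "f \<in> left_linear A (bimod H)" and g: "g \<in> left_linear A N"
    and N: "commuting_actions A N"
  shows "tensor_lift A (\<lambda>(x, y). f (x \<otimes>\<^bsub>H\<^esub> tgt H (g y))) \<in> left_linear A (tensor A (bimod H) N)"
proof -
  interpret N: commuting_actions A N by (rule N)
  interpret HN: tensor_factors A "bimod H" N ..
  note bal = convolution_balanced[OF f g N]
  note lift_hom = HN.tensor_lift_hom[OF A.abelian_group_axioms bal]
  have "tensor_lift A (\<lambda>(x, y). f (x \<otimes>\<^bsub>H\<^esub> tgt H (g y))) (lact (tensor A (bimod H) N) a z)
      = a \<otimes>\<^bsub>A\<^esub> tensor_lift A (\<lambda>(x, y). f (x \<otimes>\<^bsub>H\<^esub> tgt H (g y))) z"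
    if a: "a \<in> carrier A" and z: "z \<in> carrier (tensor A (bimod H) N)" for a z
  proof -
    have "tensor_lift A (\<lambda>(x, y). f (x \<otimes>\<^bsub>H\<^esub> tgt H (g y))) (lact (tensor A (bimod H) N) a z)
        = tensor_lift A (\<lambda>(x, y). f (src H a \<otimes>\<^bsub>H\<^esub> x \<otimes>\<^bsub>H\<^esub> tgt H (g y))) z"
      using HN.tensor_lift_lact[OF A.abelian_group_axioms bal a z] by simp
    also have "\<dots> = tensor_lift A (\<lambda>p. a \<otimes>\<^bsub>A\<^esub> (\<lambda>(x, y). f (x \<otimes>\<^bsub>H\<^esub> tgt H (g y))) p) z"
      by (rule sym, rule HN.tensor_lift_cong[OF A.abelian_group_axioms balanced_hom[OF bal mult_hom_add[OF a]] z])
        (use a left_linear_bimod[OF f] left_linear_closed[OF g] in \<open>simp add: H.m_assoc\<close>)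
    also have "\<dots> = a \<otimes>\<^bsub>A\<^esub> tensor_lift A (\<lambda>(x, y). f (x \<otimes>\<^bsub>H\<^esub> tgt H (g y))) z"
      using HN.hom_tensor_lift[OF A.abelian_group_axioms A.abelian_group_axioms bal mult_hom_add[OF a] z] by simp
    finally show ?thesis .
  qed
  with lift_hom show ?thesis by (simp add: left_linear_def)
qed

lemma left_linear_comult:
  assumes "F \<in> left_linear A HH"
  shows "(\<lambda>u. F (comult H u)) \<in> left_linear A (bimod H)"
  using hom_compose[OF comult_hom_add left_linear_hom[OF assms]] left_linear_lact[OF assms]
  by (auto simp: left_linear_def comult_src comp_def hom_def)

lemma convolve_left_linear:
  assumes "f \<in> left_linear A (bimod H)" "g \<in> left_linear A (bimod H)"
  shows "convolve A H f g \<in> left_linear A (bimod H)"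
  using left_linear_comult[OF tensor_lift_left_linear[OF assms commuting_actions_bimod]]
  by (simp add: convolve_def[abs_def])

lemma convolve_closed:
  assumes "f \<in> left_linear A (bimod H)" "g \<in> left_linear A (bimod H)" "u \<in> carrier H"
  shows "convolve A H f g u \<in> carrier A"
  using left_linear_bimod(1)[OF convolve_left_linear[OF assms(1,2)] assms(3)] .

lemma left_linear_tgt:
  assumes "g \<in> left_linear A (bimod H)" "b \<in> carrier A"
  shows "(\<lambda>y. g (y \<otimes>\<^bsub>H\<^esub> tgt H b)) \<in> left_linear A (bimod H)"
  using left_linear_bimod[OF assms(1)] assms(2)
  by (auto simp: left_linear_def[of _ "bimod H"] hom_def H.l_distr H.m_assoc)

lemma convolve_tgt:
  assumes f: "f \<in> left_linear A (bimod H)" and g: "g \<in> left_linear A (bimod H)"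
    and u: "u \<in> carrier H" and a: "a \<in> carrier A"
  shows "convolve A H f g (u \<otimes>\<^bsub>H\<^esub> tgt H a)
    = tensor_lift A (\<lambda>(x, y). f (x \<otimes>\<^bsub>H\<^esub> tgt H (g (y \<otimes>\<^bsub>H\<^esub> tgt H a)))) (comult H u)"
  using HH.tensor_lift_ract[OF A.abelian_group_axioms convolution_balanced[OF f g commuting_actions_bimod] a]
  by (simp add: convolve_def comult_tgt u a)

lemma comult_bimod_hom': "comult H \<in> bimod_hom A (bimod H) HH"
  using comult_bimod_hom by (simp add: tensor_sq_def)

text \<open>
  Both sides are values of one functional on \<open>\<H> \<otimes>\<^sub>A (\<H> \<otimes>\<^sub>A \<H>)\<close>, namely the lift of
  \<open>x \<otimes> y \<otimes> w \<mapsto> f (x t(g (y t(h w))))\<close>. At \<open>(id \<otimes> \<Delta>)(\<Delta> u)\<close> it is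
  \<open>(f * (g * h))(u)\<close>. At the reassociated \<open>(\<Delta> \<otimes> id)(\<Delta> u)\<close> it is \<open>((f * g) * h)(u)\<close>, because
  \<open>\<Delta>(x t(a)) = x\<^sub>1 \<otimes> x\<^sub>2 t(a)\<close>. Coassociativity identifies the two arguments.
\<close>

lemma convolve_assoc:
  assumes f: "f \<in> left_linear A (bimod H)" and g: "g \<in> left_linear A (bimod H)"
    and h: "h \<in> left_linear A (bimod H)" and u: "u \<in> carrier H"
  shows "convolve A H (convolve A H f g) h u = convolve A H f (convolve A H g h) u"
proof -
  note AB = A.abelian_group_axioms and cH = commuting_actions_bimod
  note cHH = HH.commuting_actions_tensor
  interpret HH_H: tensor_factors A HH "bimod H" by (intro tensor_factors.intro cH cHH)
  interpret H_HH: tensor_factors A "bimod H" HH by (intro tensor_factors.intro cH cHH)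
  \<comment> \<open>the inner functional \<open>y \<otimes> w \<mapsto> g (y t(h w))\<close>; its value at \<open>\<Delta> y\<close> is \<open>(g * h)(y)\<close>\<close>
  define G where "G = tensor_lift A (\<lambda>(y, w). g (y \<otimes>\<^bsub>H\<^esub> tgt H (h w)))"
  have G: "G \<in> left_linear A HH"
    unfolding G_def by (rule tensor_lift_left_linear[OF g h cH])
  have G_pure: "G (pure A (bimod H) (bimod H) y w) = g (y \<otimes>\<^bsub>H\<^esub> tgt H (h w))"
    if "y \<in> carrier H" "w \<in> carrier H" for y w
    unfolding G_def using that HH.tensor_lift_pure[OF AB convolution_balanced[OF g h cH]] by simp
  have G_comult: "G (comult H y) = convolve A H g h y" for y
    by (simp add: G_def convolve_def)
  let ?f = "\<lambda>(x, z). f (x \<otimes>\<^bsub>H\<^esub> tgt H (G z))"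
  have f_bal: "balanced A (bimod H) HH A ?f"
    by (rule convolution_balanced[OF f G cHH])
  have "convolve A H f (convolve A H g h) u
      = tensor_lift A (\<lambda>(x, y). ?f (x, comult H y)) (comult H u)"
    by (simp add: convolve_def[of A H f "convolve A H g h"] G_comult)
  also have "\<dots> = tensor_lift A ?f (tensor_map A (bimod H) HH (\<lambda>x. x) (comult H) (comult H u))"
    using u by (intro sym[OF HH.tensor_lift_tensor_map[OF H_HH.tensor_factors_axioms AB
            id_bimod_hom comult_bimod_hom' f_bal]]) simp
  also have "\<dots> = tensor_lift A ?f (tensor_assoc A (bimod H) (bimod H) (bimod H)
      (tensor_map A HH (bimod H) (comult H) (\<lambda>x. x) (comult H u)))"
    using coassoc[OF u] by (simp add: tensor_sq_def)
  also have "\<dots> = tensor_lift A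
      (\<lambda>(z, w). tensor_lift A (\<lambda>(x, y). ?f (x, pure A (bimod H) (bimod H) y w)) z)
      (tensor_map A HH (bimod H) (comult H) (\<lambda>x. x) (comult H u))"
    (is "_ = tensor_lift A ?F _")
    by (rule tensor_lift_tensor_assoc[OF HH.tensor_factors_axioms HH.tensor_factors_axioms AB f_bal])
      (use hom_in_carrier[OF HH.tensor_map_hom[OF HH_H.tensor_factors_axioms comult_bimod_hom' id_bimod_hom]] u
        in simp)
  also have "\<dots> = tensor_lift A (\<lambda>(x, w). ?F (comult H x, w)) (comult H u)"
  proof (rule HH.tensor_lift_tensor_map[OF HH_H.tensor_factors_axioms AB comult_bimod_hom' id_bimod_hom])
    show "balanced A HH (bimod H) A ?F"
    proof (rule HH.balanced_tensor_lift[OF AB cH])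
      fix w assume w: "w \<in> carrier (bimod H)"
      show "balanced A (bimod H) (bimod H) A (\<lambda>(x, y). ?f (x, pure A (bimod H) (bimod H) y w))"
        using balanced_factors[OF f_bal, of "\<lambda>x. x" "bimod H" "\<lambda>y. pure A (bimod H) (bimod H) y w" "bimod H"]
          balancedD(1)[OF HH.pure_balanced w] w by (simp add: HH.lact_pure hom_def)
    next
      fix x y assume xy: "x \<in> carrier (bimod H)" "y \<in> carrier (bimod H)"
      show "(\<lambda>w. case (x, y) of (x, y) \<Rightarrow> ?f (x, pure A (bimod H) (bimod H) y w))
          \<in> hom (add_monoid (bimod H)) (add_monoid A)"
        using hom_compose[OF balancedD(2)[OF HH.pure_balanced xy(2)] balancedD(2)[OF f_bal xy(1)]]
        by (simp add: comp_def)
    next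
      fix a x y w
      assume "a \<in> carrier A" "x \<in> carrier (bimod H)" "y \<in> carrier (bimod H)" "w \<in> carrier (bimod H)"
      then show "(case (x, ract (bimod H) y a) of (x, y) \<Rightarrow> ?f (x, pure A (bimod H) (bimod H) y w))
          = (case (x, y) of (x, y) \<Rightarrow> ?f (x, pure A (bimod H) (bimod H) y (lact (bimod H) a w)))"
        using balancedD(3)[OF HH.pure_balanced, of y a w] by simp
    qed
  qed (use u in simp)
  also have "\<dots> = convolve A H (convolve A H f g) h u"
    unfolding convolve_def[of A H "convolve A H f g"]
  proof (rule sym, rule HH.tensor_lift_cong[OF AB])
    show "balanced A (bimod H) (bimod H) A (\<lambda>(x, w). convolve A H f g (x \<otimes>\<^bsub>H\<^esub> tgt H (h w)))"
      by (rule convolution_balanced[OF convolve_left_linear[OF f g] h cH])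
    fix x w assume "x \<in> carrier (bimod H)" "w \<in> carrier (bimod H)"
    then have x: "x \<in> carrier H" and w: "w \<in> carrier H" by simp_all
    note g' = left_linear_tgt[OF g left_linear_bimod(1)[OF h w]]
    have "convolve A H f g (x \<otimes>\<^bsub>H\<^esub> tgt H (h w)) = tensor_lift A
        (\<lambda>(x, y). f (x \<otimes>\<^bsub>H\<^esub> tgt H (g (y \<otimes>\<^bsub>H\<^esub> tgt H (h w))))) (comult H x)"
      using convolve_tgt[OF f g x] left_linear_bimod(1)[OF h w] by simp
    also have "\<dots> = ?F (comult H x, w)"
      unfolding prod.case
      by (rule HH.tensor_lift_cong[OF AB convolution_balanced[OF f g' cH]])
        (use x w in \<open>simp_all add: G_pure\<close>)
    finally show "(case (x, w) of (x, w) \<Rightarrow> convolve A H f g (x \<otimes>\<^bsub>H\<^esub> tgt H (h w)))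
        = (case (x, w) of (x, w) \<Rightarrow> ?F (comult H x, w))" by simp
  qed (use u in simp)
  finally show ?thesis by simp
qed

text \<open>
  \<open>f (u\<^sub>1 t(\<epsilon> u\<^sub>2))\<close>: pull the additive \<open>f\<close> out of the lift and apply counitality inside.
\<close>

lemma convolve_counit_right:
  assumes f: "f \<in> left_linear A (bimod H)" and u: "u \<in> carrier H"
  shows "convolve A H f (counit H) u = f u"
proof -
  have bal: "balanced A (bimod H) (bimod H) H (\<lambda>(x, y). x \<otimes>\<^bsub>H\<^esub> tgt H (counit H y))"
    by (auto simp: balanced_def hom_def H.l_distr H.r_distr counit_add tgt_add counit_mult
        tgt_mult H.m_assoc)
  have "f (tensor_lift H (\<lambda>(x, y). x \<otimes>\<^bsub>H\<^esub> tgt H (counit H y)) (comult H u))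
      = tensor_lift A (\<lambda>p. f ((\<lambda>(x, y). x \<otimes>\<^bsub>H\<^esub> tgt H (counit H y)) p)) (comult H u)"
    by (rule HH.hom_tensor_lift[OF H.abelian_group_axioms A.abelian_group_axioms bal])
      (use left_linear_hom[OF f] u in \<open>auto simp: hom_def\<close>)
  also have "(\<lambda>p. f ((\<lambda>(x, y). x \<otimes>\<^bsub>H\<^esub> tgt H (counit H y)) p))
      = (\<lambda>(x, y). f (x \<otimes>\<^bsub>H\<^esub> tgt H (counit H y)))"
    by auto
  finally show ?thesis
    using counit_right[OF u] by (simp add: convolve_def)
qed

text \<open>
  \<open>\<epsilon> (u\<^sub>1 t(f u\<^sub>2)) = \<epsilon>(u\<^sub>1) f(u\<^sub>2) = f (s(\<epsilon> u\<^sub>1) u\<^sub>2)\<close> by left linearity of \<open>f\<close>; then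
  counitality applies as before.
\<close>

lemma convolve_counit_left:
  assumes f: "f \<in> left_linear A (bimod H)" and u: "u \<in> carrier H"
  shows "convolve A H (counit H) f u = f u"
proof -
  note bal' = convolution_balanced[OF counit_left_linear f commuting_actions_bimod]
  have bal: "balanced A (bimod H) (bimod H) H (\<lambda>(x, y). src H (counit H x) \<otimes>\<^bsub>H\<^esub> y)"
    by (auto simp: balanced_def hom_def H.l_distr H.r_distr counit_add src_add counit_mult
        src_mult H.m_assoc)
  have "f (tensor_lift H (\<lambda>(x, y). src H (counit H x) \<otimes>\<^bsub>H\<^esub> y) (comult H u))
      = tensor_lift A (\<lambda>p. f ((\<lambda>(x, y). src H (counit H x) \<otimes>\<^bsub>H\<^esub> y) p)) (comult H u)"
    by (rule HH.hom_tensor_lift[OF H.abelian_group_axioms A.abelian_group_axioms bal])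
      (use left_linear_hom[OF f] u in \<open>auto simp: hom_def\<close>)
  also have "\<dots> = convolve A H (counit H) f u"
    unfolding convolve_def
    by (rule sym, rule HH.tensor_lift_cong[OF A.abelian_group_axioms bal'])
      (use left_linear_bimod[OF f] u in \<open>simp_all add: counit_mult\<close>)
  finally show ?thesis
    using counit_left[OF u] by simp
qed

end

section \<open>Convolution of derivations\<close>

context comm_hopf_algebroid
begin

lemma mult_balanced:
  assumes f: "balanced A (bimod H) (bimod H) B f" and mn: "m \<in> carrier H" "n \<in> carrier H"
  shows "balanced A (bimod H) (bimod H) B (\<lambda>(m', n'). f (m \<otimes>\<^bsub>H\<^esub> m', n \<otimes>\<^bsub>H\<^esub> n'))"
    and "balanced A (bimod H) (bimod H) B (\<lambda>(m', n'). f (m' \<otimes>\<^bsub>H\<^esub> m, n' \<otimes>\<^bsub>H\<^esub> n))"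
  by (rule balanced_factors[OF f]; use mn in \<open>simp add: hom_def H.r_distr H.l_distr H.m_ac\<close>)+

lemma HH_mult:
  "z \<otimes>\<^bsub>HH\<^esub> w = tensor_lift HH (\<lambda>(m, n). tensor_lift HH
    (\<lambda>(m', n'). pure A (bimod H) (bimod H) (m \<otimes>\<^bsub>H\<^esub> m') (n \<otimes>\<^bsub>H\<^esub> n')) w) z"
  unfolding HH.tensor_lift_into_tensor[symmetric] by (simp add: tensor_def Let_def)

lemma HH_one: "\<one>\<^bsub>HH\<^esub> = pure A (bimod H) (bimod H) \<one>\<^bsub>H\<^esub> \<one>\<^bsub>H\<^esub>"
  by (simp add: tensor_def Let_def)

lemma comult_mult: "\<lbrakk>u \<in> carrier H; v \<in> carrier H\<rbrakk> \<Longrightarrow>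
    comult H (u \<otimes>\<^bsub>H\<^esub> v) = comult H u \<otimes>\<^bsub>HH\<^esub> comult H v"
  and comult_one: "comult H \<one>\<^bsub>H\<^esub> = pure A (bimod H) (bimod H) \<one>\<^bsub>H\<^esub> \<one>\<^bsub>H\<^esub>"
  using comult_hom unfolding HH_one[symmetric]
  by (simp_all add: alg_hom_def ring_hom_def tensor_sq_def)

lemma mult_lift_balanced:
  assumes B: "abelian_group B" and f: "balanced A (bimod H) (bimod H) B f"
    and w: "w \<in> carrier HH"
  shows "balanced A (bimod H) (bimod H) B
    (\<lambda>(m, n). tensor_lift B (\<lambda>(m', n'). f (m \<otimes>\<^bsub>H\<^esub> m', n \<otimes>\<^bsub>H\<^esub> n')) w)"
proof -
  have "balanced A (bimod H) (bimod H) B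
      (\<lambda>p. tensor_lift B ((\<lambda>(m, n) (m', n'). f (m \<otimes>\<^bsub>H\<^esub> m', n \<otimes>\<^bsub>H\<^esub> n')) p) w)"
  proof (rule HH.balanced_tensor_lift_param[OF B _ _ commuting_actions_bimod commuting_actions_bimod w])
    fix q assume "q \<in> carrier (bimod H) \<times> carrier (bimod H)"
    then obtain m n where q: "q = (m, n)" "m \<in> carrier H" "n \<in> carrier H" by auto
    show "balanced A (bimod H) (bimod H) B ((\<lambda>(m, n) (m', n'). f (m \<otimes>\<^bsub>H\<^esub> m', n \<otimes>\<^bsub>H\<^esub> n')) q)"
      using mult_balanced(1)[OF f q(2,3)] q(1) by simp
    show "balanced A (bimod H) (bimod H) B (\<lambda>p. (\<lambda>(m, n) (m', n'). f (m \<otimes>\<^bsub>H\<^esub> m', n \<otimes>\<^bsub>H\<^esub> n')) p q)"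
      using mult_balanced(2)[OF f q(2,3)] q(1) by (simp add: case_prod_unfold)
  qed
  then show ?thesis by (simp add: case_prod_unfold)
qed

text \<open>
  For \<open>f\<close> on \<open>\<H> \<otimes>\<^sub>A \<H>\<close> this is \<open>f ((u v)\<^sub>1, (u v)\<^sub>2) = f (u\<^sub>1 v\<^sub>1, u\<^sub>2 v\<^sub>2)\<close> in Sweedler
  notation, with a separate lift for \<open>\<Delta> u\<close> and \<open>\<Delta> v\<close>.
\<close>

lemma tensor_lift_comult_mult:
  assumes B: "abelian_group B" and f: "balanced A (bimod H) (bimod H) B f"
    and u: "u \<in> carrier H" and v: "v \<in> carrier H"
  shows "tensor_lift B f (comult H (u \<otimes>\<^bsub>H\<^esub> v)) =
    tensor_lift B (\<lambda>(m, n). tensor_lift B (\<lambda>(m', n'). f (m \<otimes>\<^bsub>H\<^esub> m', n \<otimes>\<^bsub>H\<^esub> n')) (comult H v)) (comult H u)"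
proof -
  let ?p = "\<lambda>(m, n). pure A (bimod H) (bimod H) m n"
  let ?g = "\<lambda>(m, n). tensor_lift HH (\<lambda>(m', n'). ?p (m \<otimes>\<^bsub>H\<^esub> m', n \<otimes>\<^bsub>H\<^esub> n')) (comult H v)"
  note T = HH.abelian_group_tensor and v' = comult_closed[OF v] and u' = comult_closed[OF u]
  note pb = HH.pure_balanced and fh = HH.tensor_lift_hom[OF B f]
  have "tensor_lift B f (comult H (u \<otimes>\<^bsub>H\<^esub> v)) = tensor_lift B f (tensor_lift HH ?g (comult H u))"
    by (simp add: comult_mult u v HH_mult)
  also have "\<dots> = tensor_lift B (\<lambda>p. tensor_lift B f (?g p)) (comult H u)"
    by (rule HH.hom_tensor_lift[OF T B mult_lift_balanced[OF T pb v'] fh u'])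
  also have "\<dots> = tensor_lift B (\<lambda>(m, n). tensor_lift B (\<lambda>(m', n'). f (m \<otimes>\<^bsub>H\<^esub> m', n \<otimes>\<^bsub>H\<^esub> n')) (comult H v)) (comult H u)"
  proof (rule sym, rule HH.tensor_lift_cong[OF B mult_lift_balanced[OF B f v'] u'])
    fix m n assume "m \<in> carrier (bimod H)" "n \<in> carrier (bimod H)"
    then have mn: "m \<in> carrier H" "n \<in> carrier H" by simp_all
    have "tensor_lift B f (?g (m, n)) = tensor_lift B
        (\<lambda>q. tensor_lift B f ((\<lambda>(m', n'). ?p (m \<otimes>\<^bsub>H\<^esub> m', n \<otimes>\<^bsub>H\<^esub> n')) q)) (comult H v)"
      using HH.hom_tensor_lift[OF T B mult_balanced(1)[OF pb mn] fh v'] by simp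
    also have "\<dots> = tensor_lift B (\<lambda>(m', n'). f (m \<otimes>\<^bsub>H\<^esub> m', n \<otimes>\<^bsub>H\<^esub> n')) (comult H v)"
      by (rule sym, rule HH.tensor_lift_cong[OF B mult_balanced(1)[OF f mn] v'])
        (use mn in \<open>simp add: HH.tensor_lift_pure[OF B f]\<close>)
    finally show "(case (m, n) of (m, n) \<Rightarrow> tensor_lift B (\<lambda>(m', n'). f (m \<otimes>\<^bsub>H\<^esub> m', n \<otimes>\<^bsub>H\<^esub> n')) (comult H v))
        = tensor_lift B f (?g (m, n))" by simp
  qed
  finally show ?thesis .
qed

lemma balanced_mult:
  assumes "balanced A M N A f" and "c \<in> carrier A"
  shows "balanced A M N A (\<lambda>x. c \<otimes>\<^bsub>A\<^esub> f x)"
  using balanced_hom[OF assms(1) mult_hom_add[OF assms(2)]] .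

text \<open>
  Four summands are what the expansion of \<open>\<delta> (u\<^sub>1 v\<^sub>1 t(\<delta>'(u\<^sub>2 v\<^sub>2)))\<close> by the two Leibniz rules
  produces.
\<close>

lemma tensor_lift_combination:
  assumes c: "c1 \<in> carrier A" "c2 \<in> carrier A" "c3 \<in> carrier A" "c4 \<in> carrier A"
    and f: "balanced A (bimod H) (bimod H) A f1" "balanced A (bimod H) (bimod H) A f2"
      "balanced A (bimod H) (bimod H) A f3" "balanced A (bimod H) (bimod H) A f4"
    and z: "z \<in> carrier HH"
  shows "tensor_lift A (\<lambda>x. c1 \<otimes>\<^bsub>A\<^esub> f1 x \<oplus>\<^bsub>A\<^esub> c2 \<otimes>\<^bsub>A\<^esub> f2 x \<oplus>\<^bsub>A\<^esub> c3 \<otimes>\<^bsub>A\<^esub> f3 x \<oplus>\<^bsub>A\<^esub> c4 \<otimes>\<^bsub>A\<^esub> f4 x) z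
    = c1 \<otimes>\<^bsub>A\<^esub> tensor_lift A f1 z \<oplus>\<^bsub>A\<^esub> c2 \<otimes>\<^bsub>A\<^esub> tensor_lift A f2 z
      \<oplus>\<^bsub>A\<^esub> c3 \<otimes>\<^bsub>A\<^esub> tensor_lift A f3 z \<oplus>\<^bsub>A\<^esub> c4 \<otimes>\<^bsub>A\<^esub> tensor_lift A f4 z"
proof -
  note AB = A.abelian_group_axioms
  have mult: "tensor_lift A (\<lambda>x. c \<otimes>\<^bsub>A\<^esub> g x) z = c \<otimes>\<^bsub>A\<^esub> tensor_lift A g z"
    if "c \<in> carrier A" "balanced A (bimod H) (bimod H) A g" for c g
    using HH.hom_tensor_lift[OF AB AB that(2) mult_hom_add[OF that(1)] z] by simp
  note b = balanced_mult[OF f(1) c(1)] balanced_mult[OF f(2) c(2)] balanced_mult[OF f(3) c(3)]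
    balanced_mult[OF f(4) c(4)]
  note b12 = balanced_add[OF AB b(1,2)]
  note b123 = balanced_add[OF AB b12 b(3)]
  show ?thesis
    by (simp only: HH.tensor_lift_add[OF AB b123 b(4) z] HH.tensor_lift_add[OF AB b12 b(3) z]
        HH.tensor_lift_add[OF AB b(1,2) z] mult c f)
qed

lemma
  assumes d: "d \<in> src_derivations k A H"
  shows src_derivation_left_linear: "d \<in> left_linear A (bimod H)"
    and src_derivation_mult: "\<lbrakk>u \<in> carrier H; v \<in> carrier H\<rbrakk> \<Longrightarrow>
      d (u \<otimes>\<^bsub>H\<^esub> v) = counit H u \<otimes>\<^bsub>A\<^esub> d v \<oplus>\<^bsub>A\<^esub> d u \<otimes>\<^bsub>A\<^esub> counit H v"
    and src_derivation_extensional: "d \<in> extensional (carrier H)"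
    and src_derivation_closed: "u \<in> carrier H \<Longrightarrow> d u \<in> carrier A"
    and src_derivation_add: "\<lbrakk>u \<in> carrier H; v \<in> carrier H\<rbrakk> \<Longrightarrow>
      d (u \<oplus>\<^bsub>H\<^esub> v) = d u \<oplus>\<^bsub>A\<^esub> d v"
  using d by (auto simp: src_derivations_def left_linear_def hom_def PiE_def Pi_iff)

lemma convolve_eqI:
  assumes "u \<in> carrier H" "balanced A (bimod H) (bimod H) A F"
    and "\<And>x y. \<lbrakk>x \<in> carrier H; y \<in> carrier H\<rbrakk> \<Longrightarrow> f (x \<otimes>\<^bsub>H\<^esub> tgt H (g y)) = F (x, y)"
  shows "convolve A H f g u = tensor_lift A F (comult H u)"
  unfolding convolve_def
  by (rule sym, rule HH.tensor_lift_cong[OF A.abelian_group_axioms assms(2)]) (use assms in simp_all)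

text \<open>
  The Leibniz rules of \<open>\<delta>'\<close> and then of \<open>\<delta>\<close> split \<open>\<delta> (u\<^sub>1 v\<^sub>1 t(\<delta>'(u\<^sub>2 v\<^sub>2)))\<close> into four
  products of a factor in \<open>u\<close> and a factor in \<open>v\<close>. Each factor has the shape
  \<open>f (x t(g y))\<close> with \<open>f, g\<close> among \<open>\<delta>, \<delta>', \<epsilon>\<close>, so its lift is a convolution, and the
  convolutions with \<open>\<epsilon>\<close> collapse by the unit laws.
\<close>

lemma convolve_mult:
  assumes d: "d \<in> src_derivations k A H" and d': "d' \<in> src_derivations k A H"
    and u: "u \<in> carrier H" and v: "v \<in> carrier H"
  shows "convolve A H d d' (u \<otimes>\<^bsub>H\<^esub> v) =
    counit H u \<otimes>\<^bsub>A\<^esub> convolve A H d d' v \<oplus>\<^bsub>A\<^esub> d u \<otimes>\<^bsub>A\<^esub> d' v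
      \<oplus>\<^bsub>A\<^esub> d' u \<otimes>\<^bsub>A\<^esub> d v \<oplus>\<^bsub>A\<^esub> convolve A H d d' u \<otimes>\<^bsub>A\<^esub> counit H v"
proof -
  let ?e = "counit H"
  let ?c = "\<lambda>f g (x, y). f (x \<otimes>\<^bsub>H\<^esub> tgt H (g y))"
  note AB = A.abelian_group_axioms and v' = comult_closed[OF v] and u' = comult_closed[OF u]
  note dl = src_derivation_left_linear[OF d] and dl' = src_derivation_left_linear[OF d']
    and el = counit_left_linear
  have bal: "balanced A (bimod H) (bimod H) A (?c f g)"
    if "f \<in> left_linear A (bimod H)" "g \<in> left_linear A (bimod H)" for f g
    using convolution_balanced[OF that commuting_actions_bimod] .
  have lift: "tensor_lift A (?c f g) (comult H w) = convolve A H f g w" for f g w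
    by (simp add: convolve_def)
  have cl: "?c f g x \<in> carrier A"
    if "f \<in> left_linear A (bimod H)" "g \<in> left_linear A (bimod H)" "x \<in> carrier H \<times> carrier H" for f g x
    using balancedD(4)[OF bal[OF that(1,2)], of "fst x" "snd x"] that(3) by auto
  \<comment> \<open>\<open>f * g\<close> is the lift of \<open>?c f g\<close>\<close>
  have expand: "?c d d' (m \<otimes>\<^bsub>H\<^esub> m', n \<otimes>\<^bsub>H\<^esub> n') =
      ?c ?e ?e (m, n) \<otimes>\<^bsub>A\<^esub> ?c d d' (m', n') \<oplus>\<^bsub>A\<^esub> ?c d ?e (m, n) \<otimes>\<^bsub>A\<^esub> ?c ?e d' (m', n')
      \<oplus>\<^bsub>A\<^esub> ?c ?e d' (m, n) \<otimes>\<^bsub>A\<^esub> ?c d ?e (m', n') \<oplus>\<^bsub>A\<^esub> ?c d d' (m, n) \<otimes>\<^bsub>A\<^esub> ?c ?e ?e (m', n')"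
    if mn: "m \<in> carrier H" "n \<in> carrier H" "m' \<in> carrier H" "n' \<in> carrier H" for m n m' n'
  proof -
    note dc = src_derivation_closed[OF d] src_derivation_closed[OF d']
    have "(m \<otimes>\<^bsub>H\<^esub> m') \<otimes>\<^bsub>H\<^esub> tgt H (d' (n \<otimes>\<^bsub>H\<^esub> n'))
      = (m \<otimes>\<^bsub>H\<^esub> tgt H (?e n)) \<otimes>\<^bsub>H\<^esub> (m' \<otimes>\<^bsub>H\<^esub> tgt H (d' n'))
        \<oplus>\<^bsub>H\<^esub> (m \<otimes>\<^bsub>H\<^esub> tgt H (d' n)) \<otimes>\<^bsub>H\<^esub> (m' \<otimes>\<^bsub>H\<^esub> tgt H (?e n'))"
      using mn dc by (simp add: src_derivation_mult[OF d'] tgt_add tgt_mult H.r_distr H.m_ac H.a_ac)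
    with mn dc show ?thesis
      by (simp add: src_derivation_add[OF d] src_derivation_mult[OF d] A.a_ac)
  qed
  have inner: "tensor_lift A (\<lambda>(m', n'). ?c d d' (m \<otimes>\<^bsub>H\<^esub> m', n \<otimes>\<^bsub>H\<^esub> n')) (comult H v) =
      convolve A H d d' v \<otimes>\<^bsub>A\<^esub> ?c ?e ?e (m, n) \<oplus>\<^bsub>A\<^esub> d' v \<otimes>\<^bsub>A\<^esub> ?c d ?e (m, n)
      \<oplus>\<^bsub>A\<^esub> d v \<otimes>\<^bsub>A\<^esub> ?c ?e d' (m, n) \<oplus>\<^bsub>A\<^esub> ?e v \<otimes>\<^bsub>A\<^esub> ?c d d' (m, n)"
    if mn: "m \<in> carrier H" "n \<in> carrier H" for m n
  proof -
    have "tensor_lift A (\<lambda>(m', n'). ?c d d' (m \<otimes>\<^bsub>H\<^esub> m', n \<otimes>\<^bsub>H\<^esub> n')) (comult H v)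
      = tensor_lift A (\<lambda>q. ?c ?e ?e (m, n) \<otimes>\<^bsub>A\<^esub> ?c d d' q \<oplus>\<^bsub>A\<^esub> ?c d ?e (m, n) \<otimes>\<^bsub>A\<^esub> ?c ?e d' q
      \<oplus>\<^bsub>A\<^esub> ?c ?e d' (m, n) \<otimes>\<^bsub>A\<^esub> ?c d ?e q \<oplus>\<^bsub>A\<^esub> ?c d d' (m, n) \<otimes>\<^bsub>A\<^esub> ?c ?e ?e q) (comult H v)"
      by (rule HH.tensor_lift_cong[OF AB mult_balanced(1)[OF bal[OF dl dl'] mn] v'])
        (use expand mn in simp)
    also have "\<dots> = ?c ?e ?e (m, n) \<otimes>\<^bsub>A\<^esub> convolve A H d d' v \<oplus>\<^bsub>A\<^esub> ?c d ?e (m, n) \<otimes>\<^bsub>A\<^esub> convolve A H ?e d' v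
      \<oplus>\<^bsub>A\<^esub> ?c ?e d' (m, n) \<otimes>\<^bsub>A\<^esub> convolve A H d ?e v \<oplus>\<^bsub>A\<^esub> ?c d d' (m, n) \<otimes>\<^bsub>A\<^esub> convolve A H ?e ?e v"
      unfolding lift[symmetric]
      by (rule tensor_lift_combination) (use mn in \<open>intro cl bal dl dl' el v'; simp\<close>)+
    finally show ?thesis
      using mn cl[OF _ _, of _ _ "(m, n)"] dl dl' el v
      by (simp only: convolve_counit_left convolve_counit_right A.m_comm mem_Times_iff fst_conv snd_conv
          convolve_closed src_derivation_closed[OF d] src_derivation_closed[OF d'] counit_closed simp_thms)
  qed
  have "convolve A H d d' (u \<otimes>\<^bsub>H\<^esub> v) = tensor_lift A
      (\<lambda>(m, n). tensor_lift A (\<lambda>(m', n'). ?c d d' (m \<otimes>\<^bsub>H\<^esub> m', n \<otimes>\<^bsub>H\<^esub> n')) (comult H v)) (comult H u)"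
    unfolding lift[symmetric] by (rule tensor_lift_comult_mult[OF AB bal[OF dl dl'] u v])
  also have "\<dots> = tensor_lift A (\<lambda>p. convolve A H d d' v \<otimes>\<^bsub>A\<^esub> ?c ?e ?e p \<oplus>\<^bsub>A\<^esub> d' v \<otimes>\<^bsub>A\<^esub> ?c d ?e p
      \<oplus>\<^bsub>A\<^esub> d v \<otimes>\<^bsub>A\<^esub> ?c ?e d' p \<oplus>\<^bsub>A\<^esub> ?e v \<otimes>\<^bsub>A\<^esub> ?c d d' p) (comult H u)"
    by (rule HH.tensor_lift_cong[OF AB mult_lift_balanced[OF AB bal[OF dl dl'] v'] u'])
      (use inner in simp)
  also have "\<dots> = convolve A H d d' v \<otimes>\<^bsub>A\<^esub> convolve A H ?e ?e u \<oplus>\<^bsub>A\<^esub> d' v \<otimes>\<^bsub>A\<^esub> convolve A H d ?e u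
      \<oplus>\<^bsub>A\<^esub> d v \<otimes>\<^bsub>A\<^esub> convolve A H ?e d' u \<oplus>\<^bsub>A\<^esub> ?e v \<otimes>\<^bsub>A\<^esub> convolve A H d d' u"
    unfolding lift[symmetric]
    by (rule tensor_lift_combination)
      (use v src_derivation_closed[OF d] src_derivation_closed[OF d'] in
        \<open>(intro bal dl dl' el u')?; simp add: lift convolve_closed dl dl'\<close>)+
  finally show ?thesis
    using u v dl dl' el src_derivation_closed[OF d] src_derivation_closed[OF d']
    by (simp add: convolve_counit_left convolve_counit_right convolve_closed A.m_comm)
qed

interpretation kA: algebra k A by (rule base_algebra)
interpretation kH: algebra k H by (rule total_algebra)

lemma smult_as_mult: "\<lbrakk>c \<in> carrier k; a \<in> carrier A\<rbrakk> \<Longrightarrow> c \<odot>\<^bsub>A\<^esub> a = (c \<odot>\<^bsub>A\<^esub> \<one>\<^bsub>A\<^esub>) \<otimes>\<^bsub>A\<^esub> a"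
  by (simp add: kA.smult_assoc2)

lemma smult_as_src: "\<lbrakk>c \<in> carrier k; u \<in> carrier H\<rbrakk> \<Longrightarrow> c \<odot>\<^bsub>H\<^esub> u = src H (c \<odot>\<^bsub>A\<^esub> \<one>\<^bsub>A\<^esub>) \<otimes>\<^bsub>H\<^esub> u"
  by (simp add: kH.smult_assoc2 src_smult src_one)

lemma smult_hom_add: "c \<in> carrier k \<Longrightarrow> (\<odot>\<^bsub>A\<^esub>) c \<in> hom (add_monoid A) (add_monoid A)"
  by (auto simp: hom_def kA.smult_r_distr)

text \<open>
  The two conditions on derivations that are left to show follow: \<open>c \<cdot> u = s(c \<cdot> 1) u\<close> gives
  \<open>k\<close>-linearity, and \<open>\<delta>(s(a)) = a \<delta>(1)\<close> vanishes since the Leibniz rule at \<open>1 \<cdot> 1\<close> gives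
  \<open>\<delta>(1) = 0\<close>.
\<close>

lemma src_derivationsI:
  assumes d: "d \<in> left_linear A (bimod H)" and ext: "d \<in> extensional (carrier H)"
    and mult: "\<And>u v. \<lbrakk>u \<in> carrier H; v \<in> carrier H\<rbrakk> \<Longrightarrow>
      d (u \<otimes>\<^bsub>H\<^esub> v) = counit H u \<otimes>\<^bsub>A\<^esub> d v \<oplus>\<^bsub>A\<^esub> d u \<otimes>\<^bsub>A\<^esub> counit H v"
  shows "d \<in> src_derivations k A H"
proof -
  note dl = left_linear_bimod[OF d]
  have one: "d \<one>\<^bsub>H\<^esub> = \<zero>\<^bsub>A\<^esub>"
    using mult[of "\<one>\<^bsub>H\<^esub>" "\<one>\<^bsub>H\<^esub>"] dl(1)[of "\<one>\<^bsub>H\<^esub>"] A.add.l_cancel_one'[of "d \<one>\<^bsub>H\<^esub>" "d \<one>\<^bsub>H\<^esub>"]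
    by (simp add: counit_one)
  have "d (src H a) = \<zero>\<^bsub>A\<^esub>" if "a \<in> carrier A" for a
    using dl(3)[of a "\<one>\<^bsub>H\<^esub>"] that one by simp
  moreover have "d (c \<odot>\<^bsub>H\<^esub> u) = c \<odot>\<^bsub>A\<^esub> d u" if "c \<in> carrier k" "u \<in> carrier H" for c u
    using dl(3)[of "c \<odot>\<^bsub>A\<^esub> \<one>\<^bsub>A\<^esub>" u] that dl(1)[of u] by (simp add: smult_as_src smult_as_mult[of c "d u"])
  ultimately show ?thesis
    using dl(1,2) ext mult by (auto simp: src_derivations_def PiE_def)
qed

lemma src_derivation_tgt:
  assumes d: "d \<in> src_derivations k A H" and "u \<in> carrier H" "a \<in> carrier A"
  shows "d (u \<otimes>\<^bsub>H\<^esub> tgt H a) = counit H u \<otimes>\<^bsub>A\<^esub> d (tgt H a) \<oplus>\<^bsub>A\<^esub> d u \<otimes>\<^bsub>A\<^esub> a"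
  using assms by (simp add: src_derivation_mult[OF d])

lemma src_derivation_smult:
  assumes d: "d \<in> src_derivations k A H" and "c \<in> carrier k" "u \<in> carrier H"
  shows "d (c \<odot>\<^bsub>H\<^esub> u) = c \<odot>\<^bsub>A\<^esub> d u"
  using assms by (auto simp: src_derivations_def)

text \<open>
  The terms \<open>d(u) d'(v) + d'(u) d(v)\<close> of \<open>convolve_mult\<close> cancel in the commutator.
\<close>

lemma src_derivations_bracket_closed:
  assumes d: "d \<in> src_derivations k A H" and d': "d' \<in> src_derivations k A H"
  shows "(\<lambda>u \<in> carrier H. convolve A H d d' u \<ominus>\<^bsub>A\<^esub> convolve A H d' d u) \<in> src_derivations k A H"
    (is "?b \<in> _")
proof (rule src_derivationsI)
  note dl = src_derivation_left_linear[OF d] and dl' = src_derivation_left_linear[OF d']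
  note cl = convolve_closed[OF dl dl'] convolve_closed[OF dl' dl]
    src_derivation_closed[OF d] src_derivation_closed[OF d']
  note c = left_linear_bimod(2,3)[OF convolve_left_linear[OF dl dl']]
    left_linear_bimod(2,3)[OF convolve_left_linear[OF dl' dl]]
  show "?b \<in> left_linear A (bimod H)"
    using c cl by (auto simp: left_linear_def hom_def a_minus_def A.minus_add A.a_ac A.r_distr A.r_minus)
  show "?b (u \<otimes>\<^bsub>H\<^esub> v) = counit H u \<otimes>\<^bsub>A\<^esub> ?b v \<oplus>\<^bsub>A\<^esub> ?b u \<otimes>\<^bsub>A\<^esub> counit H v"
    if uv: "u \<in> carrier H" "v \<in> carrier H" for u v
  proof -
    have cancel: "(p \<oplus>\<^bsub>A\<^esub> x \<oplus>\<^bsub>A\<^esub> y \<oplus>\<^bsub>A\<^esub> q) \<ominus>\<^bsub>A\<^esub> (r \<oplus>\<^bsub>A\<^esub> y \<oplus>\<^bsub>A\<^esub> x \<oplus>\<^bsub>A\<^esub> s) = (p \<ominus>\<^bsub>A\<^esub> r) \<oplus>\<^bsub>A\<^esub> (q \<ominus>\<^bsub>A\<^esub> s)"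
      if "p \<in> carrier A" "q \<in> carrier A" "r \<in> carrier A" "s \<in> carrier A" "x \<in> carrier A" "y \<in> carrier A"
      for p q r s x y
    proof -
      have "(p \<oplus>\<^bsub>A\<^esub> x \<oplus>\<^bsub>A\<^esub> y \<oplus>\<^bsub>A\<^esub> q) \<ominus>\<^bsub>A\<^esub> (r \<oplus>\<^bsub>A\<^esub> y \<oplus>\<^bsub>A\<^esub> x \<oplus>\<^bsub>A\<^esub> s)
        = (p \<ominus>\<^bsub>A\<^esub> r) \<oplus>\<^bsub>A\<^esub> (q \<ominus>\<^bsub>A\<^esub> s) \<oplus>\<^bsub>A\<^esub> (x \<ominus>\<^bsub>A\<^esub> x) \<oplus>\<^bsub>A\<^esub> (y \<ominus>\<^bsub>A\<^esub> y)"
        using that by (simp add: a_minus_def A.minus_add A.a_ac)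
      with that show ?thesis by (simp add: a_minus_def A.r_neg)
    qed
    have "?b (u \<otimes>\<^bsub>H\<^esub> v) =
      (counit H u \<otimes>\<^bsub>A\<^esub> convolve A H d d' v \<ominus>\<^bsub>A\<^esub> counit H u \<otimes>\<^bsub>A\<^esub> convolve A H d' d v)
      \<oplus>\<^bsub>A\<^esub> (convolve A H d d' u \<otimes>\<^bsub>A\<^esub> counit H v \<ominus>\<^bsub>A\<^esub> convolve A H d' d u \<otimes>\<^bsub>A\<^esub> counit H v)"
      using uv cl by (simp add: convolve_mult[OF d d'] convolve_mult[OF d' d] cancel)
    then show ?thesis
      using uv cl by (simp add: a_minus_def A.r_distr A.l_distr A.r_minus A.l_minus)
  qed
qed simp

lemma convolve_add_left:
  assumes f: "f \<in> left_linear A (bimod H)" "f' \<in> left_linear A (bimod H)" "g \<in> left_linear A (bimod H)"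
    and u: "u \<in> carrier H"
  shows "convolve A H (\<lambda>u \<in> carrier H. f u \<oplus>\<^bsub>A\<^esub> f' u) g u = convolve A H f g u \<oplus>\<^bsub>A\<^esub> convolve A H f' g u"
proof -
  note b = convolution_balanced[OF f(1,3) commuting_actions_bimod] convolution_balanced[OF f(2,3) commuting_actions_bimod]
  show ?thesis
    unfolding convolve_def[of A H f] convolve_def[of A H f']
      HH.tensor_lift_add[OF A.abelian_group_axioms b comult_closed[OF u], symmetric]
    by (rule convolve_eqI[OF u balanced_add[OF A.abelian_group_axioms b]])
      (simp add: left_linear_bimod(1)[OF f(3)])
qed

lemma convolve_add_right:
  assumes f: "f \<in> left_linear A (bimod H)" "g \<in> left_linear A (bimod H)" "g' \<in> left_linear A (bimod H)"
    and u: "u \<in> carrier H"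
  shows "convolve A H f (\<lambda>u \<in> carrier H. g u \<oplus>\<^bsub>A\<^esub> g' u) u = convolve A H f g u \<oplus>\<^bsub>A\<^esub> convolve A H f g' u"
proof -
  note b = convolution_balanced[OF f(1,2) commuting_actions_bimod] convolution_balanced[OF f(1,3) commuting_actions_bimod]
  show ?thesis
    unfolding convolve_def[of A H f g] convolve_def[of A H f g']
      HH.tensor_lift_add[OF A.abelian_group_axioms b comult_closed[OF u], symmetric]
    by (rule convolve_eqI[OF u balanced_add[OF A.abelian_group_axioms b]])
      (simp add: left_linear_bimod(1)[OF f(2)] left_linear_bimod(1)[OF f(3)] left_linear_bimod(2)[OF f(1)]
        tgt_add H.r_distr)
qed

lemma convolve_minus_left:
  assumes f: "f \<in> left_linear A (bimod H)" "f' \<in> left_linear A (bimod H)" "g \<in> left_linear A (bimod H)"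
    and u: "u \<in> carrier H"
  shows "convolve A H (\<lambda>u \<in> carrier H. f u \<ominus>\<^bsub>A\<^esub> f' u) g u = convolve A H f g u \<ominus>\<^bsub>A\<^esub> convolve A H f' g u"
proof -
  note b = convolution_balanced[OF f(1,3) commuting_actions_bimod] convolution_balanced[OF f(2,3) commuting_actions_bimod]
  show ?thesis
    unfolding convolve_def[of A H f] convolve_def[of A H f']
      HH.tensor_lift_minus[OF A.abelian_group_axioms b comult_closed[OF u], symmetric]
    by (rule convolve_eqI[OF u balanced_minus[OF A.abelian_group_axioms b]])
      (simp add: left_linear_bimod(1)[OF f(3)])
qed

lemma left_linear_tgt_minus:
  assumes f: "f \<in> left_linear A (bimod H)" and "x \<in> carrier H" "a \<in> carrier A" "b \<in> carrier A"
  shows "f (x \<otimes>\<^bsub>H\<^esub> tgt H (a \<ominus>\<^bsub>A\<^esub> b)) = f (x \<otimes>\<^bsub>H\<^esub> tgt H a) \<ominus>\<^bsub>A\<^esub> f (x \<otimes>\<^bsub>H\<^esub> tgt H b)"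
proof -
  have "(\<lambda>b. f (x \<otimes>\<^bsub>H\<^esub> tgt H b)) \<in> hom (add_monoid A) (add_monoid A)"
    using left_linear_bimod[OF f] assms(2) by (auto simp: hom_def tgt_add H.r_distr)
  then interpret h: group_hom "add_monoid A" "add_monoid A" "\<lambda>b. f (x \<otimes>\<^bsub>H\<^esub> tgt H b)"
    by (simp add: group_hom_def group_hom_axioms_def A.a_group)
  show ?thesis
    using assms h.hom_mult[of a "\<ominus>\<^bsub>A\<^esub> b"] h.hom_inv[of b] by (simp add: a_minus_def a_inv_def)
qed

lemma convolve_minus_right:
  assumes f: "f \<in> left_linear A (bimod H)" "g \<in> left_linear A (bimod H)" "g' \<in> left_linear A (bimod H)"
    and u: "u \<in> carrier H"
  shows "convolve A H f (\<lambda>u \<in> carrier H. g u \<ominus>\<^bsub>A\<^esub> g' u) u = convolve A H f g u \<ominus>\<^bsub>A\<^esub> convolve A H f g' u"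
proof -
  note b = convolution_balanced[OF f(1,2) commuting_actions_bimod] convolution_balanced[OF f(1,3) commuting_actions_bimod]
  show ?thesis
    unfolding convolve_def[of A H f g] convolve_def[of A H f g']
      HH.tensor_lift_minus[OF A.abelian_group_axioms b comult_closed[OF u], symmetric]
    by (rule convolve_eqI[OF u balanced_minus[OF A.abelian_group_axioms b]])
      (simp add: left_linear_bimod(1)[OF f(2)] left_linear_bimod(1)[OF f(3)] left_linear_tgt_minus[OF f(1)])
qed

lemma convolve_hom_left:
  assumes f: "f \<in> left_linear A (bimod H)" "g \<in> left_linear A (bimod H)"
    and h: "h \<in> hom (add_monoid A) (add_monoid A)" and u: "u \<in> carrier H"
  shows "convolve A H (\<lambda>u \<in> carrier H. h (f u)) g u = h (convolve A H f g u)"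
proof -
  note b = convolution_balanced[OF f commuting_actions_bimod] and AB = A.abelian_group_axioms
  show ?thesis
    unfolding convolve_def[of A H f] HH.hom_tensor_lift[OF AB AB b h comult_closed[OF u]]
    by (rule convolve_eqI[OF u balanced_hom[OF b h]])
      (simp add: left_linear_bimod(1)[OF f(2)])
qed

lemma convolve_smult_right:
  assumes d: "d \<in> src_derivations k A H" and g: "g \<in> left_linear A (bimod H)"
    and c: "c \<in> carrier k" and u: "u \<in> carrier H"
  shows "convolve A H d (\<lambda>u \<in> carrier H. c \<odot>\<^bsub>A\<^esub> g u) u = c \<odot>\<^bsub>A\<^esub> convolve A H d g u"
proof -
  note b = convolution_balanced[OF src_derivation_left_linear[OF d] g commuting_actions_bimod]
    and AB = A.abelian_group_axioms
  have "d (x \<otimes>\<^bsub>H\<^esub> tgt H (c \<odot>\<^bsub>A\<^esub> a)) = c \<odot>\<^bsub>A\<^esub> d (x \<otimes>\<^bsub>H\<^esub> tgt H a)"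
    if "x \<in> carrier H" "a \<in> carrier A" for x a
  proof -
    have "x \<otimes>\<^bsub>H\<^esub> tgt H (c \<odot>\<^bsub>A\<^esub> a) = c \<odot>\<^bsub>H\<^esub> (x \<otimes>\<^bsub>H\<^esub> tgt H a)"
      using that c kH.smult_assoc2[of c "tgt H a" x]
      by (simp add: tgt_smult H.m_comm[of x])
    with that c show ?thesis by (simp add: src_derivation_smult[OF d])
  qed
  then show ?thesis
    unfolding convolve_def[of A H d g] HH.hom_tensor_lift[OF AB AB b smult_hom_add[OF c] comult_closed[OF u]]
    by (intro convolve_eqI[OF u balanced_hom[OF b smult_hom_add[OF c]]])
      (simp add: left_linear_bimod(1)[OF g])
qed

text \<open>
  Since \<open>t(a g(y)) = t(g y) t(a)\<close>, the Leibniz rule of \<open>d\<close> splits off \<open>t(a)\<close>; the second term is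
  \<open>d(t a) (\<epsilon> * g)\<close>, and \<open>\<epsilon>\<close> is the unit. This is where the anchor enters the bracket.
\<close>

lemma convolve_asmult_right:
  assumes d: "d \<in> src_derivations k A H" and g: "g \<in> left_linear A (bimod H)"
    and a: "a \<in> carrier A" and u: "u \<in> carrier H"
  shows "convolve A H d (\<lambda>u \<in> carrier H. a \<otimes>\<^bsub>A\<^esub> g u) u
    = a \<otimes>\<^bsub>A\<^esub> convolve A H d g u \<oplus>\<^bsub>A\<^esub> d (tgt H a) \<otimes>\<^bsub>A\<^esub> g u"
proof -
  note dl = src_derivation_left_linear[OF d] and AB = A.abelian_group_axioms
  note b = convolution_balanced[OF dl g commuting_actions_bimod]
  note e = convolution_balanced[OF counit_left_linear g commuting_actions_bimod]
  have da: "d (tgt H a) \<in> carrier A"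
    using a src_derivation_closed[OF d] by simp
  have "convolve A H d (\<lambda>u \<in> carrier H. a \<otimes>\<^bsub>A\<^esub> g u) u = tensor_lift A
      (\<lambda>p. a \<otimes>\<^bsub>A\<^esub> (\<lambda>(x, y). d (x \<otimes>\<^bsub>H\<^esub> tgt H (g y))) p
        \<oplus>\<^bsub>A\<^esub> d (tgt H a) \<otimes>\<^bsub>A\<^esub> (\<lambda>(x, y). counit H (x \<otimes>\<^bsub>H\<^esub> tgt H (g y))) p) (comult H u)"
  proof (rule convolve_eqI[OF u balanced_add[OF AB balanced_mult[OF b a] balanced_mult[OF e da]]])
    fix x y assume xy: "x \<in> carrier H" "y \<in> carrier H"
    note gy = left_linear_bimod(1)[OF g xy(2)]
    have "x \<otimes>\<^bsub>H\<^esub> tgt H (a \<otimes>\<^bsub>A\<^esub> g y) = (x \<otimes>\<^bsub>H\<^esub> tgt H (g y)) \<otimes>\<^bsub>H\<^esub> tgt H a"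
      using xy gy a by (simp add: tgt_mult H.m_ac)
    then show "d (x \<otimes>\<^bsub>H\<^esub> tgt H ((\<lambda>u \<in> carrier H. a \<otimes>\<^bsub>A\<^esub> g u) y))
      = a \<otimes>\<^bsub>A\<^esub> (case (x, y) of (x, y) \<Rightarrow> d (x \<otimes>\<^bsub>H\<^esub> tgt H (g y)))
        \<oplus>\<^bsub>A\<^esub> d (tgt H a) \<otimes>\<^bsub>A\<^esub> (case (x, y) of (x, y) \<Rightarrow> counit H (x \<otimes>\<^bsub>H\<^esub> tgt H (g y)))"
      using xy gy a da src_derivation_closed[OF d, of "x \<otimes>\<^bsub>H\<^esub> tgt H (g y)"]
      by (simp add: src_derivation_tgt[OF d] A.m_comm A.a_comm)
  qed
  also have "\<dots> = a \<otimes>\<^bsub>A\<^esub> convolve A H d g u \<oplus>\<^bsub>A\<^esub> d (tgt H a) \<otimes>\<^bsub>A\<^esub> convolve A H (counit H) g u"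
    unfolding HH.tensor_lift_add[OF AB balanced_mult[OF b a] balanced_mult[OF e da] comult_closed[OF u]]
    using HH.hom_tensor_lift[OF AB AB b mult_hom_add[OF a] comult_closed[OF u]]
      HH.hom_tensor_lift[OF AB AB e mult_hom_add[OF da] comult_closed[OF u]]
    by (simp add: convolve_def)
  finally show ?thesis
    by (simp add: convolve_counit_left[OF g u])
qed

lemma convolve_at_tgt:
  assumes f: "f \<in> left_linear A (bimod H)" and g: "g \<in> left_linear A (bimod H)" and b: "b \<in> carrier A"
  shows "convolve A H f g (tgt H b) = f (tgt H (g (tgt H b)))"
proof -
  \<comment> \<open>writing \<open>t b\<close> as \<open>1 t(b)\<close> and using \<open>\<Delta> 1 = 1 \<otimes> 1\<close>, the lift is evaluated at a pure tensor\<close>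
  have "convolve A H f g (\<one>\<^bsub>H\<^esub> \<otimes>\<^bsub>H\<^esub> tgt H b)
      = f (\<one>\<^bsub>H\<^esub> \<otimes>\<^bsub>H\<^esub> tgt H (g (\<one>\<^bsub>H\<^esub> \<otimes>\<^bsub>H\<^esub> tgt H b)))"
    unfolding convolve_tgt[OF f g H.one_closed b] comult_one
    by (subst HH.tensor_lift_pure[OF A.abelian_group_axioms
          convolution_balanced[OF f left_linear_tgt[OF g b] commuting_actions_bimod]]) simp_all
  then show ?thesis
    using b left_linear_bimod(1)[OF g, of "tgt H b"] by simp
qed

lemma src_derivations_add_closed:
  assumes d: "d \<in> src_derivations k A H" and d': "d' \<in> src_derivations k A H"
  shows "(\<lambda>u \<in> carrier H. d u \<oplus>\<^bsub>A\<^esub> d' u) \<in> src_derivations k A H"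
proof (rule src_derivationsI)
  note c = src_derivation_closed[OF d] src_derivation_closed[OF d']
  show "(\<lambda>u \<in> carrier H. d u \<oplus>\<^bsub>A\<^esub> d' u) \<in> left_linear A (bimod H)"
    using c left_linear_bimod[OF src_derivation_left_linear[OF d]]
      left_linear_bimod[OF src_derivation_left_linear[OF d']]
    by (auto simp: left_linear_def hom_def A.a_ac A.r_distr)
qed (use src_derivation_closed[OF d] src_derivation_closed[OF d'] in
  \<open>simp_all add: src_derivation_mult[OF d] src_derivation_mult[OF d'] A.a_ac A.r_distr A.l_distr\<close>)

lemma src_derivations_zero_closed: "(\<lambda>u \<in> carrier H. \<zero>\<^bsub>A\<^esub>) \<in> src_derivations k A H"
  by (rule src_derivationsI) (auto simp: left_linear_def hom_def)

lemma src_derivations_asmult_closed: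
  assumes d: "d \<in> src_derivations k A H" and a: "a \<in> carrier A"
  shows "(\<lambda>u \<in> carrier H. a \<otimes>\<^bsub>A\<^esub> d u) \<in> src_derivations k A H"
proof (rule src_derivationsI)
  show "(\<lambda>u \<in> carrier H. a \<otimes>\<^bsub>A\<^esub> d u) \<in> left_linear A (bimod H)"
    using a left_linear_bimod[OF src_derivation_left_linear[OF d]]
    by (auto simp: left_linear_def hom_def A.r_distr A.m_lcomm)
qed (use a src_derivation_closed[OF d] in
  \<open>simp_all add: src_derivation_mult[OF d] A.m_ac A.r_distr\<close>)

lemma src_derivations_smult_closed:
  assumes d: "d \<in> src_derivations k A H" and c: "c \<in> carrier k"
  shows "(\<lambda>u \<in> carrier H. c \<odot>\<^bsub>A\<^esub> d u) \<in> src_derivations k A H"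
proof -
  have "(\<lambda>u \<in> carrier H. c \<odot>\<^bsub>A\<^esub> d u) = (\<lambda>u \<in> carrier H. (c \<odot>\<^bsub>A\<^esub> \<one>\<^bsub>A\<^esub>) \<otimes>\<^bsub>A\<^esub> d u)"
    using c src_derivation_closed[OF d] by (auto intro!: restrict_ext smult_as_mult)
  with src_derivations_asmult_closed[OF d] c show ?thesis by simp
qed

lemma src_derivations_minus_closed:
  assumes d: "d \<in> src_derivations k A H"
  shows "(\<lambda>u \<in> carrier H. \<ominus>\<^bsub>A\<^esub> d u) \<in> src_derivations k A H"
proof -
  have "(\<lambda>u \<in> carrier H. \<ominus>\<^bsub>A\<^esub> d u) = (\<lambda>u \<in> carrier H. (\<ominus>\<^bsub>A\<^esub> \<one>\<^bsub>A\<^esub>) \<otimes>\<^bsub>A\<^esub> d u)"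
    using src_derivation_closed[OF d] by (auto intro!: restrict_ext simp: A.l_minus)
  with src_derivations_asmult_closed[OF d] show ?thesis by simp
qed

lemma restrict_src_derivation:
  "d \<in> src_derivations k A H \<Longrightarrow> restrict d (carrier H) = d"
  by (rule extensional_restrict) (rule src_derivation_extensional)

end

section \<open>The Lie-Rinehart algebra of a Hopf algebroid\<close>

text \<open>
  The Jacobi identity of a commutator in an associative algebra, with \<open>a, \<dots>, f\<close> standing for the
  triple products \<open>XYZ\<close>, \<open>XZY\<close>, \<open>YZX\<close>, \<open>ZYX\<close>, \<open>YXZ\<close>, \<open>ZXY\<close>.
\<close>

lemma (in abelian_group) alternating_sum_zero:
  assumes "a \<in> carrier G" "b \<in> carrier G" "c \<in> carrier G" "d \<in> carrier G" "e \<in> carrier G" "f \<in> carrier G"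
  shows "((a \<ominus> b) \<ominus> (c \<ominus> d)) \<oplus> ((c \<ominus> e) \<ominus> (f \<ominus> b)) \<oplus> ((f \<ominus> d) \<ominus> (a \<ominus> e)) = \<zero>"
proof -
  have "((a \<ominus> b) \<ominus> (c \<ominus> d)) \<oplus> ((c \<ominus> e) \<ominus> (f \<ominus> b)) \<oplus> ((f \<ominus> d) \<ominus> (a \<ominus> e))
    = (a \<ominus> a) \<oplus> (b \<ominus> b) \<oplus> (c \<ominus> c) \<oplus> (d \<ominus> d) \<oplus> (e \<ominus> e) \<oplus> (f \<ominus> f)"
    using assms by (simp add: a_minus_def minus_add a_ac)
  with assms show ?thesis
    by (simp add: a_minus_def r_neg)
qed

lemma Lie_of_simps [simp]:
  "carrier (Lie_of k A H) = src_derivations k A H"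
  "ring.zero (Lie_of k A H) = (\<lambda>u \<in> carrier H. \<zero>\<^bsub>A\<^esub>)"
  "ring.add (Lie_of k A H) d d' = (\<lambda>u \<in> carrier H. d u \<oplus>\<^bsub>A\<^esub> d' u)"
  "smult (Lie_of k A H) c d = (\<lambda>u \<in> carrier H. c \<odot>\<^bsub>A\<^esub> d u)"
  "lie (Lie_of k A H) d d' = (\<lambda>u \<in> carrier H. convolve A H d d' u \<ominus>\<^bsub>A\<^esub> convolve A H d' d u)"
  "asmult (Lie_of k A H) a d = (\<lambda>u \<in> carrier H. a \<otimes>\<^bsub>A\<^esub> d u)"
  "anchor (Lie_of k A H) d = compose (carrier A) d (tgt H)"
  by (simp_all add: Lie_of_def)

lemma amod_simps [simp]:
  "carrier (amod L) = carrier L" "ring.zero (amod L) = ring.zero L" "ring.add (amod L) = ring.add L"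
  "smult (amod L) = asmult L"
  by (simp_all add: amod_def)

lemma Der_simps [simp]:
  "carrier (Der k A) = derivations k A"
  "ring.add (Der k A) D E = (\<lambda>b \<in> carrier A. D b \<oplus>\<^bsub>A\<^esub> E b)"
  "smult (Der k A) c D = (\<lambda>b \<in> carrier A. c \<odot>\<^bsub>A\<^esub> D b)"
  "lie (Der k A) D E = (\<lambda>b \<in> carrier A. D (E b) \<ominus>\<^bsub>A\<^esub> E (D b))"
  "asmult (Der k A) a D = (\<lambda>b \<in> carrier A. a \<otimes>\<^bsub>A\<^esub> D b)"
  by (simp_all add: Der_def)

context comm_hopf_algebroid
begin

interpretation kA: algebra k A by (rule base_algebra)

lemma abelian_group_Lie_of: "abelian_group (Lie_of k A H)"
proof (rule abelian_groupI)
  fix d assume d: "d \<in> carrier (Lie_of k A H)"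
  note c = src_derivation_closed[OF d[simplified]]
  show "\<zero>\<^bsub>Lie_of k A H\<^esub> \<oplus>\<^bsub>Lie_of k A H\<^esub> d = d"
    using d c restrict_src_derivation[of d] by (auto cong: restrict_cong)
  have "(\<lambda>u \<in> carrier H. \<ominus>\<^bsub>A\<^esub> d u) \<oplus>\<^bsub>Lie_of k A H\<^esub> d = \<zero>\<^bsub>Lie_of k A H\<^esub>"
    using c by (auto intro!: restrict_ext simp: A.l_neg)
  then show "\<exists>y \<in> carrier (Lie_of k A H). y \<oplus>\<^bsub>Lie_of k A H\<^esub> d = \<zero>\<^bsub>Lie_of k A H\<^esub>"
    using src_derivations_minus_closed d by (auto simp del: Lie_of_simps(2,3))
qed (auto intro!: restrict_ext src_derivations_add_closed src_derivations_zero_closed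
    simp: A.a_ac src_derivation_closed)

lemma module_Lie_of: "module k (Lie_of k A H)"
  by (rule moduleI[OF kA.R_cring abelian_group_Lie_of])
    (auto intro!: restrict_ext src_derivations_smult_closed simp: src_derivation_closed kA.smult_l_distr
      kA.smult_r_distr kA.smult_assoc1 restrict_src_derivation cong: restrict_cong)

lemma amod_Lie_of: "module A (amod (Lie_of k A H))"
proof (rule moduleI[OF A.cring_axioms])
  interpret L: abelian_group "Lie_of k A H" by (rule abelian_group_Lie_of)
  show "abelian_group (amod (Lie_of k A H))"
    by (rule abelian_groupI; unfold amod_simps)
      (fact L.a_closed L.zero_closed L.a_assoc L.a_comm L.l_zero | erule L.add.l_inv_ex)+
qed (auto intro!: restrict_ext src_derivations_asmult_closed simp: src_derivation_closed A.l_distr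
      A.r_distr A.m_assoc restrict_src_derivation cong: restrict_cong)

lemma lie_algebra_Lie_of: "lie_algebra k (Lie_of k A H)"
proof (rule lie_algebra.intro[OF module_Lie_of], unfold_locales)
  show "lie (Lie_of k A H) X Y \<in> carrier (Lie_of k A H)"
    if "X \<in> carrier (Lie_of k A H)" "Y \<in> carrier (Lie_of k A H)" for X Y
    using that src_derivations_bracket_closed by simp
next
  fix X assume "X \<in> carrier (Lie_of k A H)"
  then have "X \<in> left_linear A (bimod H)" by (simp add: src_derivation_left_linear)
  then show "lie (Lie_of k A H) X X = \<zero>\<^bsub>Lie_of k A H\<^esub>"
    by (auto intro!: restrict_ext simp: convolve_closed a_minus_def A.r_neg)
next
  fix X Y Z
  assume "X \<in> carrier (Lie_of k A H)" "Y \<in> carrier (Lie_of k A H)" "Z \<in> carrier (Lie_of k A H)"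
  then have ll: "X \<in> left_linear A (bimod H)" "Y \<in> left_linear A (bimod H)" "Z \<in> left_linear A (bimod H)"
    by (simp_all add: src_derivation_left_linear)
  show "lie (Lie_of k A H) (X \<oplus>\<^bsub>Lie_of k A H\<^esub> Y) Z
      = lie (Lie_of k A H) X Z \<oplus>\<^bsub>Lie_of k A H\<^esub> lie (Lie_of k A H) Y Z"
    by (auto intro!: restrict_ext simp: convolve_add_left convolve_add_right convolve_closed ll
        a_minus_def A.minus_add A.a_ac)
  show "lie (Lie_of k A H) X (Y \<oplus>\<^bsub>Lie_of k A H\<^esub> Z)
      = lie (Lie_of k A H) X Y \<oplus>\<^bsub>Lie_of k A H\<^esub> lie (Lie_of k A H) X Z"
    by (auto intro!: restrict_ext simp: convolve_add_left convolve_add_right convolve_closed ll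
        a_minus_def A.minus_add A.a_ac)
  \<comment> \<open>\<open>[P, [Q, R]] = (PQR - PRQ) - (QRP - RQP)\<close>, with all products bracketed to the right\<close>
  have "convolve A H P (lie (Lie_of k A H) Q R) u \<ominus>\<^bsub>A\<^esub> convolve A H (lie (Lie_of k A H) Q R) P u
      = (convolve A H P (convolve A H Q R) u \<ominus>\<^bsub>A\<^esub> convolve A H P (convolve A H R Q) u)
        \<ominus>\<^bsub>A\<^esub> (convolve A H Q (convolve A H R P) u \<ominus>\<^bsub>A\<^esub> convolve A H R (convolve A H Q P) u)"
    if "P \<in> left_linear A (bimod H)" "Q \<in> left_linear A (bimod H)" "R \<in> left_linear A (bimod H)"
      "u \<in> carrier H" for P Q R u
    using that by (simp add: convolve_minus_left convolve_minus_right convolve_left_linear convolve_assoc)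
  note br = this
  show "lie (Lie_of k A H) X (lie (Lie_of k A H) Y Z)
      \<oplus>\<^bsub>Lie_of k A H\<^esub> lie (Lie_of k A H) Y (lie (Lie_of k A H) Z X)
      \<oplus>\<^bsub>Lie_of k A H\<^esub> lie (Lie_of k A H) Z (lie (Lie_of k A H) X Y) = \<zero>\<^bsub>Lie_of k A H\<^esub>"
    using br[unfolded Lie_of_simps] ll
    by (auto intro!: restrict_ext A.alternating_sum_zero simp: convolve_closed convolve_left_linear)
next
  fix c X Y
  assume c: "c \<in> carrier k" and XY: "X \<in> carrier (Lie_of k A H)" "Y \<in> carrier (Lie_of k A H)"
  then have d: "X \<in> src_derivations k A H" "Y \<in> src_derivations k A H"
    by simp_all
  note ll = d[THEN src_derivation_left_linear]
  show "lie (Lie_of k A H) (c \<odot>\<^bsub>Lie_of k A H\<^esub> X) Y = c \<odot>\<^bsub>Lie_of k A H\<^esub> lie (Lie_of k A H) X Y"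
    using c by (auto intro!: restrict_ext simp: convolve_hom_left[OF _ _ smult_hom_add] convolve_smult_right d ll
        convolve_closed a_minus_def kA.smult_r_distr kA.smult_r_minus)
  show "lie (Lie_of k A H) X (c \<odot>\<^bsub>Lie_of k A H\<^esub> Y) = c \<odot>\<^bsub>Lie_of k A H\<^esub> lie (Lie_of k A H) X Y"
    using c by (auto intro!: restrict_ext simp: convolve_hom_left[OF _ _ smult_hom_add] convolve_smult_right d ll
        convolve_closed a_minus_def kA.smult_r_distr kA.smult_r_minus)
qed

lemma anchor_derivation:
  assumes d: "d \<in> src_derivations k A H"
  shows "compose (carrier A) d (tgt H) \<in> derivations k A"
  using src_derivation_closed[OF d]
  by (auto simp: derivations_def compose_def tgt_add tgt_mult tgt_smult
      src_derivation_add[OF d] src_derivation_smult[OF d] src_derivation_mult[OF d])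

lemma anchor_lie_module_hom: "anchor (Lie_of k A H) \<in> lie_module_hom k A (Lie_of k A H) (Der k A)"
  by (auto simp: lie_module_hom_def anchor_derivation[unfolded compose_def restrict_def] compose_def restrict_def convolve_at_tgt
      src_derivation_left_linear src_derivation_closed)

lemma lie_rinehart_Lie_of: "lie_rinehart k A (Lie_of k A H)"
proof (rule lie_rinehart.intro[OF base_algebra lie_algebra_Lie_of amod_Lie_of _ anchor_lie_module_hom])
  show "asmult (Lie_of k A H) (c \<odot>\<^bsub>A\<^esub> a) X = c \<odot>\<^bsub>Lie_of k A H\<^esub> asmult (Lie_of k A H) a X"
    if "c \<in> carrier k" "a \<in> carrier A" "X \<in> carrier (Lie_of k A H)" for c a X
    using that by (auto intro!: restrict_ext simp: kA.smult_assoc2 src_derivation_closed)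
next
  fix a X Y
  assume a: "a \<in> carrier A" and "X \<in> carrier (Lie_of k A H)" "Y \<in> carrier (Lie_of k A H)"
  then have d: "X \<in> src_derivations k A H" "Y \<in> src_derivations k A H" by simp_all
  note ll = d[THEN src_derivation_left_linear]
  show "lie (Lie_of k A H) X (asmult (Lie_of k A H) a Y) =
    asmult (Lie_of k A H) a (lie (Lie_of k A H) X Y)
      \<oplus>\<^bsub>Lie_of k A H\<^esub> asmult (Lie_of k A H) (anchor (Lie_of k A H) X a) Y"
    using a by (auto intro!: restrict_ext simp: convolve_hom_left[OF _ _ mult_hom_add] convolve_asmult_right d ll
        convolve_closed src_derivation_closed compose_def a_minus_def A.r_distr A.r_minus A.a_ac)
qed

end

section \<open>Functoriality\<close>

lemma hopf_hom_bimod_hom: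
  assumes "comm_hopf_algebroid k A H" and \<phi>: "\<phi> \<in> hopf_hom k A H K"
  shows "\<phi> \<in> bimod_hom A (bimod H) (bimod K)"
proof -
  interpret H: comm_hopf_algebroid k A H by fact
  show ?thesis
    using \<phi> by (auto simp: hopf_hom_def alg_hom_def ring_hom_def bimod_hom_def)
qed

lemma hopf_homD:
  assumes "\<phi> \<in> hopf_hom k A H K"
  shows "u \<in> carrier H \<Longrightarrow> \<phi> u \<in> carrier K"
    and "\<phi> \<in> extensional (carrier H)"
    and "\<lbrakk>u \<in> carrier H; v \<in> carrier H\<rbrakk> \<Longrightarrow> \<phi> (u \<oplus>\<^bsub>H\<^esub> v) = \<phi> u \<oplus>\<^bsub>K\<^esub> \<phi> v"
    and "\<lbrakk>u \<in> carrier H; v \<in> carrier H\<rbrakk> \<Longrightarrow> \<phi> (u \<otimes>\<^bsub>H\<^esub> v) = \<phi> u \<otimes>\<^bsub>K\<^esub> \<phi> v"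
    and "a \<in> carrier A \<Longrightarrow> \<phi> (src H a) = src K a"
    and "a \<in> carrier A \<Longrightarrow> \<phi> (tgt H a) = tgt K a"
    and "u \<in> carrier H \<Longrightarrow> comult K (\<phi> u) = tensor_map A (bimod K) (bimod K) \<phi> \<phi> (comult H u)"
    and "u \<in> carrier H \<Longrightarrow> counit K (\<phi> u) = counit H u"
  using assms by (auto simp: hopf_hom_def alg_hom_def ring_hom_def)

lemma id_hopf_hom:
  assumes "comm_hopf_algebroid k A H"
  shows "(\<lambda>u \<in> carrier H. u) \<in> hopf_hom k A H H"
proof -
  interpret H: comm_hopf_algebroid k A H by fact
  interpret kH: algebra k H by (rule H.total_algebra)
  have "tensor_map A (bimod H) (bimod H) (\<lambda>u \<in> carrier H. u) (\<lambda>u \<in> carrier H. u) z = z"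
    if z: "z \<in> carrier (tensor A (bimod H) (bimod H))" for z
    unfolding tensor_map_def
    by (rule H.HH.tensor_lift_unique[OF H.HH.abelian_group_tensor _ _ z, where h = "\<lambda>z. z"])
      (auto simp: hom_def)
  moreover have "antipode H u \<in> carrier H" if "u \<in> carrier H" for u
    using H.antipode_hom that by (auto simp: alg_hom_def ring_hom_def)
  ultimately show ?thesis
    by (auto simp: hopf_hom_def alg_hom_def ring_hom_def)
qed

text \<open>
  Compatibility with \<open>\<Delta>\<close> is functoriality of the tensor product:
  \<open>(\<psi> \<otimes> \<psi>) \<circ> (\<phi> \<otimes> \<phi>) = \<psi>\<phi> \<otimes> \<psi>\<phi>\<close>.
\<close>

lemma compose_hopf_hom:
  assumes H: "comm_hopf_algebroid k A H" and K: "comm_hopf_algebroid k A K"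
    and L: "comm_hopf_algebroid k A L"
    and \<phi>: "\<phi> \<in> hopf_hom k A H K" and \<psi>: "\<psi> \<in> hopf_hom k A K L"
  shows "compose (carrier H) \<psi> \<phi> \<in> hopf_hom k A H L"
proof -
  interpret H: comm_hopf_algebroid k A H by (rule H)
  interpret K: comm_hopf_algebroid k A K by (rule K)
  interpret L: comm_hopf_algebroid k A L by (rule L)
  interpret kH: algebra k H by (rule H.total_algebra)
  note \<phi>b = hopf_hom_bimod_hom[OF H \<phi>] and \<psi>b = hopf_hom_bimod_hom[OF K \<psi>]
  note KK = K.HH.tensor_factors_axioms and LL = L.HH.abelian_group_tensor
  have bal: "balanced A (bimod K) (bimod K) (tensor A (bimod L) (bimod L))
      (\<lambda>(x, y). pure A (bimod L) (bimod L) (\<psi> x) (\<psi> y))"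
    using balanced_bimod_hom[OF L.HH.pure_balanced \<psi>b \<psi>b] by simp
  have bal': "balanced A (bimod H) (bimod H) (tensor A (bimod L) (bimod L))
      (\<lambda>(x, y). pure A (bimod L) (bimod L) (\<psi> (\<phi> x)) (\<psi> (\<phi> y)))"
    using balanced_bimod_hom[OF bal \<phi>b \<phi>b] by simp
  have "tensor_map A (bimod L) (bimod L) \<psi> \<psi> (tensor_map A (bimod K) (bimod K) \<phi> \<phi> z)
      = tensor_map A (bimod L) (bimod L) (compose (carrier H) \<psi> \<phi>) (compose (carrier H) \<psi> \<phi>) z"
    if z: "z \<in> carrier (tensor A (bimod H) (bimod H))" for z
  proof -
    have "tensor_map A (bimod L) (bimod L) \<psi> \<psi> (tensor_map A (bimod K) (bimod K) \<phi> \<phi> z)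
      = tensor_lift (tensor A (bimod L) (bimod L))
          (\<lambda>(x, y). pure A (bimod L) (bimod L) (\<psi> (\<phi> x)) (\<psi> (\<phi> y))) z"
      using H.HH.tensor_lift_tensor_map[OF KK LL \<phi>b \<phi>b bal z] by (simp add: tensor_map_def[of A "bimod L"])
    also have "\<dots> = tensor_map A (bimod L) (bimod L) (compose (carrier H) \<psi> \<phi>) (compose (carrier H) \<psi> \<phi>) z"
      unfolding tensor_map_def
      by (rule H.HH.tensor_lift_cong[OF LL bal' z]) (simp add: compose_def)
    finally show ?thesis .
  qed
  moreover have "antipode H u \<in> carrier H" if "u \<in> carrier H" for u
    using H.antipode_hom that by (auto simp: alg_hom_def ring_hom_def)
  ultimately show ?thesis
    using \<phi> \<psi> by (auto simp: hopf_hom_def alg_hom_def ring_hom_def compose_def Pi_iff)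
qed

lemma category_CHAlgd:
  fixes k :: "'k ring" and A :: "('k, 'a) module"
  shows "category (CHAlgd k A :: (('k, 'a, 'h) hopf_algebroid, 'h \<Rightarrow> 'h) category)"
proof
  fix W X Y Z :: "('k, 'a, 'h) hopf_algebroid" and f g h
  assume "W \<in> Obj (CHAlgd k A)" "X \<in> Obj (CHAlgd k A)" "Y \<in> Obj (CHAlgd k A)" "Z \<in> Obj (CHAlgd k A)"
    "f \<in> Hom (CHAlgd k A) W X" "g \<in> Hom (CHAlgd k A) X Y" "h \<in> Hom (CHAlgd k A) Y Z"
  then show "Comp (CHAlgd k A) W Y Z h (Comp (CHAlgd k A) W X Y g f)
      = Comp (CHAlgd k A) W X Z (Comp (CHAlgd k A) X Y Z h g) f"
    by (auto simp: CHAlgd_def hopf_homD intro!: compose_assoc)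
qed (auto simp: CHAlgd_def id_hopf_hom compose_hopf_hom hopf_homD intro: compose_Id Id_compose)

lemma lie_rinehart_closed:
  assumes "lie_rinehart k A L" and X: "X \<in> carrier L" and Y: "Y \<in> carrier L"
  shows "X \<oplus>\<^bsub>L\<^esub> Y \<in> carrier L" "c \<in> carrier k \<Longrightarrow> c \<odot>\<^bsub>L\<^esub> X \<in> carrier L"
    "a \<in> carrier A \<Longrightarrow> asmult L a X \<in> carrier L" "lie L X Y \<in> carrier L"
proof -
  interpret L: lie_rinehart k A L by fact
  interpret lie: lie_algebra k L by (rule L.lie_algebra)
  interpret amod: module A "amod L" by (rule L.amod)
  show "X \<oplus>\<^bsub>L\<^esub> Y \<in> carrier L" "c \<in> carrier k \<Longrightarrow> c \<odot>\<^bsub>L\<^esub> X \<in> carrier L" "lie L X Y \<in> carrier L"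
    using X Y lie.lie_closed by auto
  show "a \<in> carrier A \<Longrightarrow> asmult L a X \<in> carrier L"
    using X amod.smult_closed by simp
qed

lemma lie_rinehart_homD:
  assumes "f \<in> lie_rinehart_hom k A L M"
  shows "X \<in> carrier L \<Longrightarrow> f X \<in> carrier M" and "f \<in> extensional (carrier L)"
  using assms by (auto simp: lie_rinehart_hom_def lie_module_hom_def)

lemma category_LieRin:
  fixes k :: "'k ring" and A :: "('k, 'a) module"
  shows "category (LieRin k A :: (('k, 'a, 'l) lie_rinehart, 'l \<Rightarrow> 'l) category)"
proof
  fix W X Y Z :: "('k, 'a, 'l) lie_rinehart" and f g h
  assume "W \<in> Obj (LieRin k A)" "X \<in> Obj (LieRin k A)" "Y \<in> Obj (LieRin k A)" "Z \<in> Obj (LieRin k A)"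
    "f \<in> Hom (LieRin k A) W X" "g \<in> Hom (LieRin k A) X Y" "h \<in> Hom (LieRin k A) Y Z"
  then show "Comp (LieRin k A) W Y Z h (Comp (LieRin k A) W X Y g f)
      = Comp (LieRin k A) W X Z (Comp (LieRin k A) X Y Z h g) f"
    by (auto simp: LieRin_def lie_rinehart_homD intro!: compose_assoc)
next
  fix X Y Z :: "('k, 'a, 'l) lie_rinehart" and f g
  assume "X \<in> Obj (LieRin k A)" "Y \<in> Obj (LieRin k A)" "Z \<in> Obj (LieRin k A)"
    "f \<in> Hom (LieRin k A) X Y" "g \<in> Hom (LieRin k A) Y Z"
  then show "Comp (LieRin k A) X Y Z g f \<in> Hom (LieRin k A) X Z"
    by (auto simp: LieRin_def lie_rinehart_hom_def lie_module_hom_def compose_def Pi_iff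
        lie_rinehart_closed)
qed (auto simp: LieRin_def lie_rinehart_hom_def lie_module_hom_def lie_rinehart_closed
    intro: compose_Id Id_compose)

text \<open>
  \<open>f (\<phi>(u)\<^sub>1 t(g \<phi>(u)\<^sub>2)) = f (\<phi>(u\<^sub>1 t(g \<phi>(u\<^sub>2))))\<close>, as \<open>\<phi>\<close> commutes with \<open>\<Delta>\<close>, the
  product and \<open>t\<close>.
\<close>

lemma convolve_compose:
  assumes H: "comm_hopf_algebroid k A H" and K: "comm_hopf_algebroid k A K"
    and \<phi>: "\<phi> \<in> hopf_hom k A H K"
    and f: "f \<in> left_linear A (bimod K)" and g: "g \<in> left_linear A (bimod K)" and u: "u \<in> carrier H"
  shows "convolve A H (compose (carrier H) f \<phi>) (compose (carrier H) g \<phi>) u = convolve A K f g (\<phi> u)"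
proof -
  interpret H: comm_hopf_algebroid k A H by (rule H)
  interpret K: comm_hopf_algebroid k A K by (rule K)
  note \<phi>b = hopf_hom_bimod_hom[OF H \<phi>] and AB = H.A.abelian_group_axioms
  note b = K.convolution_balanced[OF f g K.commuting_actions_bimod]
  note b' = balanced_bimod_hom[OF b \<phi>b \<phi>b]
  have "convolve A K f g (\<phi> u)
      = tensor_lift A (\<lambda>(x, y). f (\<phi> x \<otimes>\<^bsub>K\<^esub> tgt K (g (\<phi> y)))) (comult H u)"
    using H.HH.tensor_lift_tensor_map[OF K.HH.tensor_factors_axioms AB \<phi>b \<phi>b b] u
    by (simp add: convolve_def hopf_homD(7)[OF \<phi>])
  also have "\<dots> = convolve A H (compose (carrier H) f \<phi>) (compose (carrier H) g \<phi>) u"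
    unfolding convolve_def
    by (rule H.HH.tensor_lift_cong[OF AB]) (use b' u in \<open>simp_all add: compose_def hopf_homD[OF \<phi>]
        K.left_linear_bimod(1)[OF g]\<close>)
  finally show ?thesis by simp
qed

lemma compose_src_derivation:
  assumes H: "comm_hopf_algebroid k A H" and K: "comm_hopf_algebroid k A K"
    and \<phi>: "\<phi> \<in> hopf_hom k A H K" and d: "d \<in> src_derivations k A K"
  shows "compose (carrier H) d \<phi> \<in> src_derivations k A H"
proof -
  interpret H: comm_hopf_algebroid k A H by (rule H)
  interpret K: comm_hopf_algebroid k A K by (rule K)
  note dl = K.left_linear_bimod[OF K.src_derivation_left_linear[OF d]]
  show ?thesis
  proof (rule H.src_derivationsI)
    show "compose (carrier H) d \<phi> \<in> left_linear A (bimod H)"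
      using dl by (auto simp: left_linear_def hom_def compose_def hopf_homD[OF \<phi>])
  qed (simp_all add: compose_def hopf_homD[OF \<phi>] K.src_derivation_mult[OF d])
qed

lemma Lie_of_arr_hom:
  assumes H: "comm_hopf_algebroid k A H" and K: "comm_hopf_algebroid k A K"
    and \<phi>: "\<phi> \<in> hopf_hom k A H K"
  shows "Lie_of_arr k A H K \<phi> \<in> lie_rinehart_hom k A (Lie_of k A K) (Lie_of k A H)"
proof -
  interpret H: comm_hopf_algebroid k A H by (rule H)
  interpret K: comm_hopf_algebroid k A K by (rule K)
  let ?F = "Lie_of_arr k A H K \<phi>"
  have F: "?F d = compose (carrier H) d \<phi>" if "d \<in> src_derivations k A K" for d
    using that by (simp add: Lie_of_arr_def)
  note closed = compose_src_derivation[OF H K \<phi>] K.src_derivations_add_closed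
    K.src_derivations_smult_closed K.src_derivations_asmult_closed K.src_derivations_bracket_closed
  show ?thesis
    unfolding lie_rinehart_hom_def lie_module_hom_def
  proof (intro CollectI IntI conjI ballI Pi_I)
    show "?F \<in> extensional (carrier (Lie_of k A K))"
      by (simp add: Lie_of_arr_def)
  next
    fix d assume d: "d \<in> carrier (Lie_of k A K)"
    then show "?F d \<in> carrier (Lie_of k A H)"
      by (simp add: F closed)
    show "anchor (Lie_of k A H) (?F d) = anchor (Lie_of k A K) d"
      using d by (auto simp: F compose_def hopf_homD[OF \<phi>] intro!: restrict_ext)
    show "?F (c \<odot>\<^bsub>Lie_of k A K\<^esub> d) = c \<odot>\<^bsub>Lie_of k A H\<^esub> ?F d" if "c \<in> carrier k" for c
      using d that by (auto simp: F closed compose_def hopf_homD[OF \<phi>] intro!: restrict_ext)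
    show "?F (asmult (Lie_of k A K) a d) = asmult (Lie_of k A H) a (?F d)" if "a \<in> carrier A" for a
      using d that by (auto simp: F closed compose_def hopf_homD[OF \<phi>] intro!: restrict_ext)
    fix d' assume d': "d' \<in> carrier (Lie_of k A K)"
    show "?F (d \<oplus>\<^bsub>Lie_of k A K\<^esub> d') = ?F d \<oplus>\<^bsub>Lie_of k A H\<^esub> ?F d'"
      using d d' by (auto simp: F closed compose_def hopf_homD[OF \<phi>] intro!: restrict_ext)
    have "?F (lie (Lie_of k A K) d d') = compose (carrier H) (lie (Lie_of k A K) d d') \<phi>"
      using d d' by (simp add: F closed)
    then show "?F (lie (Lie_of k A K) d d') = lie (Lie_of k A H) (?F d) (?F d')"
      using d d' by (auto simp: F closed convolve_compose[OF H K \<phi>] K.src_derivation_left_linear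
          compose_eq hopf_homD[OF \<phi>] intro!: extensionalityI[of _ "carrier H"])
  qed
qed

theorem proposition5p16:
  fixes k :: "'k ring" and A :: "('k, 'a) module"
  assumes "field k" and "char_zero k" and "algebra k A"
  shows "contravariant_functor
    (CHAlgd k A :: (('k, 'a, 'h) hopf_algebroid, 'h \<Rightarrow> 'h) category)
    (LieRin k A :: (('k, 'a, 'h \<Rightarrow> 'a) lie_rinehart, ('h \<Rightarrow> 'a) \<Rightarrow> ('h \<Rightarrow> 'a)) category)
    (Lie_of k A) (Lie_of_arr k A)"
proof (intro contravariant_functor.intro contravariant_functor_axioms.intro category_CHAlgd category_LieRin)
  fix H :: "('k, 'a, 'h) hopf_algebroid"
  assume "H \<in> Obj (CHAlgd k A)"
  then interpret H: comm_hopf_algebroid k A H by (simp add: CHAlgd_def)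
  show "Lie_of k A H \<in> Obj (LieRin k A)"
    by (simp add: LieRin_def H.lie_rinehart_Lie_of)
  show "Lie_of_arr k A H H (Idt (CHAlgd k A) H) = Idt (LieRin k A) (Lie_of k A H)"
    unfolding Lie_of_arr_def CHAlgd_def LieRin_def
    by (auto intro!: restrict_ext compose_Id simp: H.src_derivation_closed H.src_derivation_extensional)
next
  fix H K :: "('k, 'a, 'h) hopf_algebroid" and \<phi>
  assume "H \<in> Obj (CHAlgd k A)" "K \<in> Obj (CHAlgd k A)" "\<phi> \<in> Hom (CHAlgd k A) H K"
  then show "Lie_of_arr k A H K \<phi> \<in> Hom (LieRin k A) (Lie_of k A K) (Lie_of k A H)"
    by (simp add: CHAlgd_def LieRin_def Lie_of_arr_hom)
next
  fix H K L :: "('k, 'a, 'h) hopf_algebroid" and \<phi> \<psi>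
  assume objs: "H \<in> Obj (CHAlgd k A)" "K \<in> Obj (CHAlgd k A)" "L \<in> Obj (CHAlgd k A)"
    and "\<phi> \<in> Hom (CHAlgd k A) H K" "\<psi> \<in> Hom (CHAlgd k A) K L"
  then have "\<phi> \<in> hopf_hom k A H K" "\<psi> \<in> hopf_hom k A K L"
    and "comm_hopf_algebroid k A K" "comm_hopf_algebroid k A L"
    by (simp_all add: CHAlgd_def)
  then show "Lie_of_arr k A H L (Comp (CHAlgd k A) H K L \<psi> \<phi>)
      = Comp (LieRin k A) (Lie_of k A L) (Lie_of k A K) (Lie_of k A H)
          (Lie_of_arr k A H K \<phi>) (Lie_of_arr k A K L \<psi>)"
    by (auto simp: Lie_of_arr_def CHAlgd_def LieRin_def compose_src_derivation
        compose_def[of "src_derivations k A L"] hopf_homD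
        intro!: restrict_ext compose_assoc)
qed

end
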